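(* Let $F$ be Thompson's group with standard generators $x_0,x_1$. Let $(G_n)_{n<\omega}$ be a convergent sequence of marked groups, where $G_n=(F,(g_n,x_0,x_1))$, $g_n\in F$ for $n<\omega$, and let $(G,(g,x_0,x_1))$ be its limit. Then $G$ is not an HNN-extension of $F$ of the form $F\ast_H=\langle F,g\mid [g,h]=1,\ h\in H\rangle$, where $H$ is some subgroup of $F$ such that there exist $h',h''\in H$ with $\{0,1\}\subseteq\overline{supp}(h')\cup\overline{supp}(h'')$ (here $F$ is the subgroup $\langle x_0,x_1\rangle$ of $G$ and the stable letter is the marking element $g$).
   Context: Thompson's group $F$ is the group, under composition, of all strictly increasing continuous piecewise-linear functions from $[0,1]$ onto itself which are differentiable except at finitely many dyadic rationals and all of whose slopes are integer powers of $2$. It is generated by $x_0,x_1$, where $x_0(t)=t/2$ on $[0,\frac12]$, $t-\frac14$ on $[\frac12,\frac34]$, $2t-1$ on $[\frac34,1]$; and $x_1(t)=t$ on $[0,\frac12]$, $\frac t2+\frac14$ on $[\frac12,\frac34]$, $t-\frac18$ on $[\frac34,\frac78]$, $2t-1$ on $[\frac78,1]$. For $f\in F$, $supp(f)=\{t\in[0,1]: f(t)\neq t\}$ and $\overline{supp}(f)$ is its closure in $[0,1]$. A marked group $(G,S)$ is a group $G$ with a finite ordered tuple of generators $S=(s_1,\ldots,s_m)$. On the set $\mathcal{G}_m$ of groups marked by $m$ generators (up to isomorphism of marked groups) two marked groups are at distance at most $e^{-R}$ if they have exactly the same relations of length at most $R$. Convergence and limits are with respect to this metric. In the limit $(G,(g,x_0,x_1))$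 the elements $x_0,x_1$ are the limits of the constant sequences $x_0$, $x_1$ and generate a copy of $F$; $g$ is the limit of $(g_n)_{n<\omega}$. *)

theory Defs
  imports "HOL-Analysis.Analysis" "HOL-Algebra.Bij" "HOL-Algebra.Generated_Groups"
begin

section \<open>Thompson's group\<close>

definition dyadic_rationals :: "real set" where
  "dyadic_rationals = {real_of_int k / 2 ^ n | k n. True}"

definition piecewise_linear :: "(real \<Rightarrow> real) \<Rightarrow> bool" where
  "piecewise_linear f \<longleftrightarrow>
     (\<exists>P. finite P \<and>
       (\<forall>a b. 0 \<le> a \<and> a < b \<and> b \<le> 1 \<and> {a<..<b} \<inter> P = {} \<longrightarrow>
          (\<exists>m c. \<forall>t\<in>{a..b}. f t = m * t + c)))"

text \<open>
  Elements of the group are functions on the unit interval, hence \<^const>\<open>extensional\<close> as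
  members of the full group of bijections \<^const>\<open>BijGroup\<close>. The slopes are the values of the
  derivative wherever it exists in the open interval; a linear piece ending at 0 or 1 has interior
  points, so its slope is covered as well.
\<close>

definition thompson_elements :: "(real \<Rightarrow> real) set" where
  "thompson_elements =
     {f \<in> extensional {0..1}.
        f ` {0..1} = {0..1} \<and> strict_mono_on {0..1} f \<and> continuous_on {0..1} f \<and>
        piecewise_linear f \<and>
        (\<exists>D. finite D \<and> D \<subseteq> dyadic_rationals \<and>
             (\<forall>t\<in>{0<..<1} - D. f differentiable (at t))) \<and>
        (\<forall>t\<in>{0<..<1}. \<forall>d. (f has_real_derivative d) (at t) \<longrightarrow>
             (\<exists>k::int. d = 2 powi k))}"

definition ThompsonF :: "(real \<Rightarrow> real) monoid" where
  "ThompsonF = (BijGroup {0..1}) \<lparr>carrier := thompson_elements\<rparr>"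

definition x0 :: "real \<Rightarrow> real" where
  "x0 = (\<lambda>t\<in>{0..1}.
     if t \<le> 1/2 then t / 2
     else if t \<le> 3/4 then t - 1/4
     else 2 * t - 1)"

definition x1 :: "real \<Rightarrow> real" where
  "x1 = (\<lambda>t\<in>{0..1}.
     if t \<le> 1/2 then t
     else if t \<le> 3/4 then t / 2 + 1/4
     else if t \<le> 7/8 then t - 1/8
     else 2 * t - 1)"

definition supp :: "(real \<Rightarrow> real) \<Rightarrow> real set" where
  "supp f = {t \<in> {0..1}. f t \<noteq> t}"

section \<open>Group words\<close>

text \<open>A letter \<open>(x, True)\<close> stands for \<open>x\<close>, and \<open>(x, False)\<close> for its inverse.\<close>

type_synonym 'x gword = "('x \<times> bool) list"

definition gwords :: "'x set \<Rightarrow> 'x gword set" where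
  "gwords X = lists (X \<times> UNIV)"

section \<open>Marked groups\<close>

type_synonym ('a, 'b) marked = "('a, 'b) monoid_scheme \<times> 'a list"

definition marked_group :: "('a, 'b) marked \<Rightarrow> bool" where
  "marked_group M \<longleftrightarrow>
     (case M of (G, S) \<Rightarrow> group G \<and> set S \<subseteq> carrier G \<and> generate G (set S) = carrier G)"

fun word_value :: "('a, 'b) marked \<Rightarrow> nat gword \<Rightarrow> 'a" where
  "word_value (G, S) [] = \<one>\<^bsub>G\<^esub>"
| "word_value (G, S) ((i, s) # w) =
     (if s then S ! i else inv\<^bsub>G\<^esub> (S ! i)) \<otimes>\<^bsub>G\<^esub> word_value (G, S) w"

definition relations_upto :: "('a, 'b) marked \<Rightarrow> nat \<Rightarrow> nat gword set" where
  "relations_upto M R =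
     {w \<in> gwords {..<length (snd M)}. length w \<le> R \<and> word_value M w = \<one>\<^bsub>fst M\<^esub>}"

text \<open>
  The least distance satisfying the defining property of the metric on marked groups: two of them
  are at distance at most \<open>exp (- R)\<close> if they have the same relations of length at most \<open>R\<close>. The
  set is nonempty because \<open>R = 0\<close> always qualifies. The two groups may have different element
  types, since marked groups are considered up to isomorphism.
\<close>

definition marked_dist :: "('a, 'b) marked \<Rightarrow> ('c, 'd) marked \<Rightarrow> real" where
  "marked_dist M N = Inf {exp (- real R) | R. relations_upto M R = relations_upto N R}"

definition marked_converges :: "(nat \<Rightarrow> ('a, 'b) marked) \<Rightarrow> ('c, 'd) marked \<Rightarrow> bool" where
  "marked_converges M N \<longleftrightarrow> (\<lambda>n. marked_dist (M n) N) \<longlonglongrightarrow> 0"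

section \<open>Groups given by presentations\<close>

inductive_set presentation_rel :: "'x set \<Rightarrow> 'x gword set \<Rightarrow> ('x gword \<times> 'x gword) set"
  for X :: "'x set" and R :: "'x gword set" where
  refl: "w \<in> gwords X \<Longrightarrow> (w, w) \<in> presentation_rel X R"
| sym: "(v, w) \<in> presentation_rel X R \<Longrightarrow> (w, v) \<in> presentation_rel X R"
| trans: "(u, v) \<in> presentation_rel X R \<Longrightarrow> (v, w) \<in> presentation_rel X R \<Longrightarrow>
    (u, w) \<in> presentation_rel X R"
| cancel: "u \<in> gwords X \<Longrightarrow> v \<in> gwords X \<Longrightarrow> x \<in> X \<Longrightarrow>
    (u @ [(x, s), (x, \<not> s)] @ v, u @ v) \<in> presentation_rel X R"
| relator: "u \<in> gwords X \<Longrightarrow> v \<in> gwords X \<Longrightarrow> r \<in> R \<Longrightarrow> r \<in> gwords X \<Longrightarrow>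
    (u @ r @ v, u @ v) \<in> presentation_rel X R"

definition presented_group :: "'x set \<Rightarrow> 'x gword set \<Rightarrow> 'x gword set monoid" where
  "presented_group X R =
     \<lparr>carrier = gwords X // presentation_rel X R,
      monoid.mult = (\<lambda>A B. \<Union>u\<in>A. \<Union>v\<in>B. presentation_rel X R `` {u @ v}),
      one = presentation_rel X R `` {[]}\<rparr>"

section \<open>HNN extensions with trivially acting stable letter\<close>

text \<open>
  The HNN extension \<open>\<langle>A, t | [t, h] = 1, h \<in> H\<rangle>\<close> of \<open>A\<close> for the identity isomorphism from \<open>H\<close> to
  \<open>H\<close>. The base group \<open>A\<close> is presented by all its elements and its multiplication table.
\<close>

datatype 'a hnn_letter = Base 'a | Stable

definition hnn_generators :: "('a, 'b) monoid_scheme \<Rightarrow> 'a hnn_letter set" where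
  "hnn_generators A = insert Stable (Base ` carrier A)"

definition hnn_relators :: "('a, 'b) monoid_scheme \<Rightarrow> 'a set \<Rightarrow> 'a hnn_letter gword set" where
  "hnn_relators A H =
     {[(Base a, True), (Base b, True), (Base (a \<otimes>\<^bsub>A\<^esub> b), False)] | a b.
        a \<in> carrier A \<and> b \<in> carrier A} \<union>
     {[(Stable, False), (Base h, False), (Stable, True), (Base h, True)] | h. h \<in> H}"

definition HNN :: "('a, 'b) monoid_scheme \<Rightarrow> 'a set \<Rightarrow> 'a hnn_letter gword set monoid" where
  "HNN A H = presented_group (hnn_generators A) (hnn_relators A H)"

definition HNN_generator ::
  "('a, 'b) monoid_scheme \<Rightarrow> 'a set \<Rightarrow> 'a hnn_letter \<Rightarrow> 'a hnn_letter gword set" where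
  "HNN_generator A H x =
     presentation_rel (hnn_generators A) (hnn_relators A H) `` {[(x, True)]}"

text \<open>
  \<open>G\<close> is the HNN extension of the subgroup \<open>i ` carrier A\<close>, identified with \<open>A\<close> by \<open>i\<close>, with stable
  letter \<open>t\<close>. Injectivity of \<open>i\<close> is not demanded since a base group always embeds into its HNN
  extension.
\<close>

definition is_HNN_extension ::
  "('c, 'd) monoid_scheme \<Rightarrow> ('a, 'b) monoid_scheme \<Rightarrow> ('a \<Rightarrow> 'c) \<Rightarrow> 'a set \<Rightarrow> 'c \<Rightarrow> bool" where
  "is_HNN_extension G A i H t \<longleftrightarrow>
     i \<in> hom A G \<and>
     (\<exists>\<psi> \<in> iso (HNN A H) G.
        (\<forall>a \<in> carrier A. \<psi> (HNN_generator A H (Base a)) = i a) \<and>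
        \<psi> (HNN_generator A H Stable) = t)"

end

theory Submission
  imports Defs
begin

text \<open>
  Suppose the limit is such an HNN extension. Two consequences of Britton's lemma are used: if
  \<open>g f g\<^sup>-\<^sup>1\<close> commutes with \<open>f\<close>, or \<open>f g f\<^sup>-\<^sup>1\<close> commutes with \<open>g\<close>, for some \<open>f \<in> F\<close>, then \<open>f \<in> H\<close>, so
  that \<open>f\<close> commutes with \<open>g\<close>, and hence with \<open>g\<^sub>n\<close> for large \<open>n\<close>.

  Some \<open>h \<in> H\<close> has slope different from 1 at 0. As \<open>g\<^sub>n\<close> commutes with \<open>h\<close> for large \<open>n\<close>, there is
  \<open>e > 0\<close> independent of \<open>n\<close> such that \<open>g\<^sub>n\<close> is \<open>t \<mapsto> 2\<^sup>k t\<close> on \<open>[0, e]\<close> as long as its values stay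
  below \<open>e\<close>. So \<open>g\<^sub>n\<close> either fixes \<open>[0, e]\<close> or moves \<open>(e/2, e)\<close> off itself. For \<open>f\<close> supported in
  \<open>(e/2, e)\<close>, the conjugate of \<open>f\<close> by \<open>g\<^sub>n\<close> commutes with \<open>f\<close> in either case. Thus \<open>f \<in> H\<close>, so \<open>g\<^sub>n\<close>
  commutes with \<open>f\<close>, and the second case is impossible for large \<open>n\<close>. The same holds at 1, so \<open>g\<^sub>n\<close>
  is supported in \<open>[e, 1 - e]\<close>. An element \<open>f \<in> F\<close> moving this interval off itself makes
  \<open>f g\<^sub>n f\<^sup>-\<^sup>1\<close> commute with \<open>g\<^sub>n\<close>. Again \<open>f \<in> H\<close> commutes with \<open>g\<^sub>n\<close>, which forces \<open>g\<^sub>n = 1\<close> and \<open>g = 1\<close>,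
  a contradiction.
\<close>

section \<open>Thompson's group as a group\<close>

lemma dyadic_rationals_of_int [simp]: "real_of_int k \<in> dyadic_rationals"
  unfolding dyadic_rationals_def by (rule CollectI, rule exI[of _ k], rule exI[of _ 0]) simp

lemma dyadic_rationals_0_1 [simp]: "0 \<in> dyadic_rationals" "1 \<in> dyadic_rationals"
  using dyadic_rationals_of_int[of 0] dyadic_rationals_of_int[of 1] by simp_all

lemma dyadic_rationals_add:
  assumes "x \<in> dyadic_rationals" "y \<in> dyadic_rationals"
  shows "x + y \<in> dyadic_rationals"
proof -
  obtain j m k n where x: "x = real_of_int j / 2 ^ m" and y: "y = real_of_int k / 2 ^ n"
    using assms unfolding dyadic_rationals_def by auto
  have "x + y = real_of_int (j * 2 ^ n + k * 2 ^ m) / 2 ^ (m + n)"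
    unfolding x y by (simp add: field_simps power_add)
  then show ?thesis
    unfolding dyadic_rationals_def by blast
qed

lemma dyadic_rationals_minus:
  assumes "x \<in> dyadic_rationals"
  shows "- x \<in> dyadic_rationals"
proof -
  obtain j m where "x = real_of_int j / 2 ^ m"
    using assms unfolding dyadic_rationals_def by auto
  then have "- x = real_of_int (- j) / 2 ^ m"
    by simp
  then show ?thesis
    unfolding dyadic_rationals_def by blast
qed

lemma dyadic_rationals_diff:
  assumes "x \<in> dyadic_rationals" "y \<in> dyadic_rationals"
  shows "x - y \<in> dyadic_rationals"
  using dyadic_rationals_add[OF assms(1) dyadic_rationals_minus[OF assms(2)]] by simp

lemma dyadic_rationals_powi:
  assumes "x \<in> dyadic_rationals"
  shows "2 powi k * x \<in> dyadic_rationals"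
proof -
  obtain j m where x: "x = real_of_int j / 2 ^ m"
    using assms unfolding dyadic_rationals_def by auto
  show ?thesis
  proof (cases "k \<ge> 0")
    case True
    then have "2 powi k * x = real_of_int (2 ^ nat k * j) / 2 ^ m"
      by (simp add: x power_int_def)
    then show ?thesis
      unfolding dyadic_rationals_def by blast
  next
    case False
    then have "2 powi k * x = real_of_int j / 2 ^ (nat (- k) + m)"
      by (simp add: x power_int_def power_add field_simps)
    then show ?thesis
      unfolding dyadic_rationals_def by blast
  qed
qed

lemma dyadic_rationals_powi_iff:
  "2 powi k * x \<in> dyadic_rationals \<longleftrightarrow> x \<in> dyadic_rationals"
proof
  assume "2 powi k * x \<in> dyadic_rationals"
  then have "2 powi (- k) * (2 powi k * x) \<in> dyadic_rationals"
    by (rule dyadic_rationals_powi)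
  moreover have "2 powi (- k) * (2 powi k * x) = x"
    by (simp add: power_int_minus field_simps)
  ultimately show "x \<in> dyadic_rationals"
    by simp
qed (rule dyadic_rationals_powi)

lemma dyadic_rationals_affine_iff:
  assumes "c \<in> dyadic_rationals"
  shows "2 powi k * x + c \<in> dyadic_rationals \<longleftrightarrow> x \<in> dyadic_rationals"
proof
  assume "2 powi k * x + c \<in> dyadic_rationals"
  from dyadic_rationals_diff[OF this assms] show "x \<in> dyadic_rationals"
    by (simp add: dyadic_rationals_powi_iff)
qed (intro dyadic_rationals_add dyadic_rationals_powi assms)

section \<open>Functions that are affine between finitely many break points\<close>

lemma finite_gap_right:
  fixes t u :: real
  assumes "finite D" "t < u"
  obtains b where "t < b" "b \<le> u" "{t<..<b} \<inter> D = {}"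
proof
  let ?b = "Min (insert u {d \<in> D. t < d})"
  show "t < ?b" "?b \<le> u"
    using assms by auto
  show "{t<..<?b} \<inter> D = {}"
    using assms by auto
qed

lemma finite_gap_left:
  fixes t u :: real
  assumes "finite D" "u < t"
  obtains b where "u \<le> b" "b < t" "{b<..<t} \<inter> D = {}"
proof
  let ?b = "Max (insert u {d \<in> D. d < t})"
  show "u \<le> ?b" "?b < t"
    using assms by auto
  show "{?b<..<t} \<inter> D = {}"
    using assms by auto
qed

text \<open>
  Unlike \<^const>\<open>piecewise_linear\<close>, this lets the slopes and the set of break points be controlled
  together, which makes it stable under composition and inversion.
\<close>

definition affine_pieces :: "real set \<Rightarrow> (real \<Rightarrow> real) \<Rightarrow> bool" where
  "affine_pieces D f \<longleftrightarrow>
     (\<forall>a b. 0 \<le> a \<and> a < b \<and> b \<le> 1 \<and> {a<..<b} \<inter> D = {} \<longrightarrow>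
        (\<exists>(k::int) c. \<forall>t\<in>{a..b}. f t = 2 powi k * t + c))"

lemma affine_piecesE:
  assumes "affine_pieces D f" "0 \<le> a" "a < b" "b \<le> 1" "{a<..<b} \<inter> D = {}"
  obtains k c where "\<And>t. a \<le> t \<Longrightarrow> t \<le> b \<Longrightarrow> f t = 2 powi k * t + c"
  using assms unfolding affine_pieces_def by (meson atLeastAtMost_iff)

lemma tendsto_affine_within:
  fixes f :: "real \<Rightarrow> real"
  assumes "\<And>x. x \<in> S \<Longrightarrow> dist x t < e \<Longrightarrow> f x = m * x + c" "e > 0" "t \<in> S"
  shows "(f \<longlongrightarrow> f t) (at t within S)"
proof (rule Lim_transform_within[OF _ \<open>e > 0\<close>])
  show "((\<lambda>x. m * x + c) \<longlongrightarrow> f t) (at t within S)"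
    using assms by (auto intro!: tendsto_eq_intros)
  show "m * x + c = f x" if "x \<in> S" "0 < dist x t" "dist x t < e" for x
    using assms that by simp
qed

text \<open>Affinity is available on closed pieces, so on each side of \<open>t\<close> there is a
  piece containing \<open>t\<close> itself, and both one-sided limits equal \<open>f t\<close>. At 0
  and 1 one of the two one-sided filters is trivial.\<close>

lemma affine_pieces_continuous_on:
  assumes "affine_pieces D f" "finite D"
  shows "continuous_on {0..1} f"
  unfolding continuous_on_def
proof
  fix t :: real
  assume t: "t \<in> {0..1}"
  have left: "(f \<longlongrightarrow> f t) (at t within {0..t})"
  proof (cases "t = 0")
    case False
    with t obtain a where a: "0 \<le> a" "a < t" "{a<..<t} \<inter> D = {}"
      using finite_gap_left[OF assms(2), of 0 t] by auto
    obtain k c where "\<And>x. a \<le> x \<Longrightarrow> x \<le> t \<Longrightarrow> f x = 2 powi k * x + c"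
      using affine_piecesE[OF assms(1) a(1,2) _ a(3)] t by auto
    then show ?thesis
      using a t by (intro tendsto_affine_within[where e = "t - a"]) (auto simp: dist_real_def)
  qed (auto simp: tendsto_def eventually_at_topological intro: exI[of _ UNIV])
  have right: "(f \<longlongrightarrow> f t) (at t within {t..1})"
  proof (cases "t = 1")
    case False
    with t obtain b where b: "t < b" "b \<le> 1" "{t<..<b} \<inter> D = {}"
      using finite_gap_right[OF assms(2), of t 1] by auto
    obtain k c where "\<And>x. t \<le> x \<Longrightarrow> x \<le> b \<Longrightarrow> f x = 2 powi k * x + c"
      using affine_piecesE[OF assms(1) _ b] t by auto
    then show ?thesis
      using b t by (intro tendsto_affine_within[where e = "b - t"]) (auto simp: dist_real_def)
  qed (auto simp: tendsto_def eventually_at_topological intro: exI[of _ UNIV])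
  have "{0..t} \<union> {t..1} = {0..1}"
    using t by auto
  with Lim_Un[OF left right] show "(f \<longlongrightarrow> f t) (at t within {0..1})"
    by simp
qed

text \<open>As \<open>t\<close> avoids \<open>D\<close>, the gaps on its two sides join to one open
  interval without break points, on which \<open>f\<close> has a single affine formula.\<close>

lemma affine_pieces_has_derivative:
  assumes "affine_pieces D f" "finite D" "t \<in> {0<..<1}" "t \<notin> D"
  obtains k :: int where "(f has_real_derivative 2 powi k) (at t)"
proof -
  obtain a where a: "0 \<le> a" "a < t" "{a<..<t} \<inter> D = {}"
    using finite_gap_left[OF assms(2), of 0 t] assms(3) by auto
  obtain b where b: "t < b" "b \<le> 1" "{t<..<b} \<inter> D = {}"
    using finite_gap_right[OF assms(2), of t 1] assms(3) by auto
  have "{a<..<b} \<inter> D = {}"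
    unfolding disjoint_iff
  proof (intro allI impI)
    fix x
    assume "x \<in> {a<..<b}"
    then consider "x \<in> {a<..<t}" | "x = t" | "x \<in> {t<..<b}"
      by fastforce
    then show "x \<notin> D"
      using a(3) b(3) assms(4) by cases blast+
  qed
  then obtain k c where *: "\<And>x. a \<le> x \<Longrightarrow> x \<le> b \<Longrightarrow> f x = 2 powi k * x + c"
    using affine_piecesE[OF assms(1) a(1) _ b(2)] a b by (meson less_trans)
  have "((\<lambda>x. 2 powi k * x + c) has_real_derivative 2 powi k) (at t)"
    by (auto intro!: derivative_eq_intros)
  moreover have "\<forall>\<^sub>F x in nhds t. 2 powi k * x + c = f x"
    using eventually_nhds_in_open[of "{a<..<b}" t] a b * by (auto elim!: eventually_mono)
  ultimately have "(f has_real_derivative 2 powi k) (at t)"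
    by (rule DERIV_cong_ev[OF HOL.refl _ HOL.refl, THEN iffD1, rotated])
  then show thesis ..
qed

text \<open>This replaces the analytic definition by data that are easy to exhibit. Surjectivity
  comes from the intermediate value theorem.\<close>

lemma thompson_elementsI:
  assumes ext: "f \<in> extensional {0..1}" and f0: "f 0 = 0" and f1: "f 1 = 1"
    and mono: "strict_mono_on {0..1} f"
    and D: "finite D" "D \<subseteq> dyadic_rationals" "affine_pieces D f"
  shows "f \<in> thompson_elements"
proof -
  have cont: "continuous_on {0..1} f"
    using affine_pieces_continuous_on D by blast
  have "f t \<in> {0..1}" if "t \<in> {0..1}" for t
    using strict_mono_onD[OF mono, of 0 t] strict_mono_onD[OF mono, of t 1] f0 f1 that
    by (cases "t = 0"; cases "t = 1") auto
  moreover have "y \<in> f ` {0..1}" if "y \<in> {0..1}" for y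
    using IVT'[of f 0 y 1] cont f0 f1 that by auto
  ultimately have image: "f ` {0..1} = {0..1}"
    by blast
  have pl: "piecewise_linear f"
    using D unfolding piecewise_linear_def affine_pieces_def by meson
  have diff: "f differentiable at t" if "t \<in> {0<..<1} - D" for t
    using affine_pieces_has_derivative[OF D(3,1), of t] that
    by (auto simp: real_differentiable_def)
  \<comment> \<open>A derivative may exist even at a point of \<open>D\<close>. It is then also the
    one-sided derivative of the affine piece to the right of \<open>t\<close>.\<close>
  have slope: "\<exists>k::int. d = 2 powi k"
    if t: "t \<in> {0<..<1}" and d: "(f has_real_derivative d) (at t)" for t d
  proof -
    obtain b where b: "t < b" "b \<le> 1" "{t<..<b} \<inter> D = {}"
      using finite_gap_right[OF D(1), of t 1] t by auto
    obtain k c where *: "\<And>x. t \<le> x \<Longrightarrow> x \<le> b \<Longrightarrow> f x = 2 powi k * x + c"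
      using affine_piecesE[OF D(3) _ b] t by auto
    have "(f has_vector_derivative d) (at t within cbox t b)"
      using d by (simp add: has_real_derivative_iff_has_vector_derivative
          has_vector_derivative_at_within)
    moreover have "((\<lambda>x. 2 powi k * x + c) has_vector_derivative 2 powi k) (at t within cbox t b)"
      by (auto intro!: derivative_eq_intros simp flip: has_real_derivative_iff_has_vector_derivative)
    then have "(f has_vector_derivative 2 powi k) (at t within cbox t b)"
      by (rule has_vector_derivative_transform[rotated 2]) (use b * in auto)
    ultimately have "d = 2 powi k"
      using vector_derivative_unique_within_closed_interval[of t b t f d "2 powi k"] b by auto
    then show ?thesis ..
  qed
  show ?thesis
    unfolding thompson_elements_def
    using ext image mono cont pl D diff slope by blast
qed

text \<open>At a point of \<open>P\<close> where \<open>f\<close> is differentiable, the slopes on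
  both sides equal the derivative, so the two pieces join into one. Induction on the number of
  points of \<open>P\<close> inside the interval removes all of them.\<close>

lemma piecewise_affine_differentiable_imp_affine:
  fixes f :: "real \<Rightarrow> real"
  assumes "finite P" "a < b"
    and "\<And>x y. a \<le> x \<Longrightarrow> x < y \<Longrightarrow> y \<le> b \<Longrightarrow> {x<..<y} \<inter> P = {} \<Longrightarrow>
           \<exists>m c. \<forall>t\<in>{x..y}. f t = m * t + c"
    and "\<And>t. a < t \<Longrightarrow> t < b \<Longrightarrow> f differentiable at t"
  shows "\<exists>m c. \<forall>t\<in>{a..b}. f t = m * t + c"
  using assms(2-)
proof (induction "card (P \<inter> {a<..<b})" arbitrary: a b rule: less_induct)
  case less
  show ?case
  proof (cases "P \<inter> {a<..<b} = {}")
    case True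
    then show ?thesis
      using less.prems by (simp add: Int_commute)
  next
    case False
    then obtain p where p: "p \<in> P" "a < p" "p < b"
      by auto
    have "card (P \<inter> {a<..<p}) < card (P \<inter> {a<..<b})" "card (P \<inter> {p<..<b}) < card (P \<inter> {a<..<b})"
      using assms(1) p by (auto intro!: psubset_card_mono)
    from less.hyps[OF this(1)] less.hyps[OF this(2)] less.prems p
    have "\<exists>m c. \<forall>t\<in>{a..p}. f t = m * t + c" "\<exists>m c. \<forall>t\<in>{p..b}. f t = m * t + c"
      by simp_all
    then obtain m1 c1 m2 c2 where l: "\<forall>t\<in>{a..p}. f t = m1 * t + c1"
      and r: "\<forall>t\<in>{p..b}. f t = m2 * t + c2"
      by blast
    obtain d where d: "(f has_real_derivative d) (at p)"
      using less.prems(3)[of p] p by (auto simp: real_differentiable_def)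
    have affine: "((\<lambda>x. m * x + c) has_vector_derivative m) (at p within S)" for m c :: real and S
      by (auto intro!: derivative_eq_intros simp flip: has_real_derivative_iff_has_vector_derivative)
    have *: "d = m" if "x < y" "p \<in> {x..y}" "\<forall>t\<in>{x..y}. f t = m * t + c" for x y m c
    proof (rule vector_derivative_unique_within_closed_interval)
      show "(f has_vector_derivative d) (at p within cbox x y)"
        using d by (simp add: has_real_derivative_iff_has_vector_derivative
            has_vector_derivative_at_within)
      show "(f has_vector_derivative m) (at p within cbox x y)"
        by (rule has_vector_derivative_transform[OF _ _ affine]) (use that in auto)
    qed (use that in auto)
    have "d = m1" "d = m2"
      using *[OF _ _ l] *[OF _ _ r] p by auto
    moreover from this have "c1 = c2"
      using l r p by (metis add_left_cancel atLeastAtMost_iff less_imp_le order_refl)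
    ultimately have "\<forall>t\<in>{a..b}. f t = d * t + c1"
      using l r p by auto
    then show ?thesis by blast
  qed
qed

text \<open>The definition does not relate the break points \<open>P\<close> of piecewise linearity
  to the set \<open>D\<close> of dyadic exceptions to differentiability. Points of \<open>P\<close>
  outside \<open>D\<close> are spurious, so \<open>D\<close> alone serves as break set. The
  derivative at the midpoint of a piece shows that its slope is a power of 2.\<close>

lemma thompson_elementsE:
  assumes "f \<in> thompson_elements"
  obtains D where "finite D" "D \<subseteq> dyadic_rationals" "affine_pieces D f"
proof -
  obtain D where D: "finite D" "D \<subseteq> dyadic_rationals"
      "\<And>t. t \<in> {0<..<1} - D \<Longrightarrow> f differentiable at t"
    using assms unfolding thompson_elements_def by auto
  obtain P where P: "finite P" "\<And>a b. 0 \<le> a \<Longrightarrow> a < b \<Longrightarrow> b \<le> 1 \<Longrightarrow> {a<..<b} \<inter> P = {} \<Longrightarrow>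
          \<exists>m c. \<forall>t\<in>{a..b}. f t = m * t + c"
    using assms unfolding thompson_elements_def piecewise_linear_def by auto
  have "affine_pieces D f"
    unfolding affine_pieces_def
  proof (intro allI impI)
    fix a b :: real
    assume ab: "0 \<le> a \<and> a < b \<and> b \<le> 1 \<and> {a<..<b} \<inter> D = {}"
    have "\<exists>m c. \<forall>t\<in>{a..b}. f t = m * t + c"
    proof (rule piecewise_affine_differentiable_imp_affine[OF P(1)])
      show "f differentiable at t" if "a < t" "t < b" for t
      proof (rule D(3))
        have "t \<in> {a<..<b}"
          using that by simp
        then show "t \<in> {0<..<1} - D"
          using ab by auto
      qed
    qed (use ab P(2) in auto)
    then obtain m c where mc: "\<forall>t\<in>{a..b}. f t = m * t + c" by blast
    let ?t = "(a + b) / 2"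
    have t: "?t \<in> {a<..<b}"
      using ab by auto
    have "((\<lambda>x. m * x + c) has_real_derivative m) (at ?t)"
      by (auto intro!: derivative_eq_intros)
    moreover have "\<forall>\<^sub>F x in nhds ?t. m * x + c = f x"
      using eventually_nhds_in_open[OF _ t] mc by (auto elim!: eventually_mono)
    ultimately have "(f has_real_derivative m) (at ?t)"
      by (rule DERIV_cong_ev[OF HOL.refl _ HOL.refl, THEN iffD1, rotated])
    moreover have "\<forall>t\<in>{0<..<1}. \<forall>d. (f has_real_derivative d) (at t) \<longrightarrow> (\<exists>k::int. d = 2 powi k)"
      using assms unfolding thompson_elements_def by auto
    moreover have "?t \<in> {0<..<1}"
      using t ab by auto
    ultimately obtain k :: int where "m = 2 powi k"
      by blast
    with mc show "\<exists>(k::int) c. \<forall>t\<in>{a..b}. f t = 2 powi k * t + c"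
      by blast
  qed
  with D show thesis
    using that by blast
qed

section \<open>Order, endpoints and dyadic points under elements of the group\<close>

lemma thompson_elements_extensional: "f \<in> thompson_elements \<Longrightarrow> f \<in> extensional {0..1}"
  and thompson_elements_image: "f \<in> thompson_elements \<Longrightarrow> f ` {0..1} = {0..1}"
  and thompson_elements_mono: "f \<in> thompson_elements \<Longrightarrow> strict_mono_on {0..1} f"
  unfolding thompson_elements_def by auto

lemma thompson_elements_less_iff:
  assumes "f \<in> thompson_elements" "s \<in> {0..1}" "t \<in> {0..1}"
  shows "f s < f t \<longleftrightarrow> s < t"
  using thompson_elements_mono[OF assms(1)] assms by (simp add: strict_mono_on_less)

lemma thompson_elements_le_iff:
  assumes "f \<in> thompson_elements" "s \<in> {0..1}" "t \<in> {0..1}"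
  shows "f s \<le> f t \<longleftrightarrow> s \<le> t"
  using thompson_elements_mono[OF assms(1)] assms by (simp add: strict_mono_on_less_eq)

lemma thompson_elements_eq_iff:
  assumes "f \<in> thompson_elements" "s \<in> {0..1}" "t \<in> {0..1}"
  shows "f s = f t \<longleftrightarrow> s = t"
  using thompson_elements_mono[OF assms(1)] assms by (simp add: strict_mono_on_eq)

lemma thompson_elements_in_unit:
  assumes "f \<in> thompson_elements" "t \<in> {0..1}"
  shows "f t \<in> {0..1}"
  using thompson_elements_image[OF assms(1)] assms(2) by blast

lemma thompson_elements_bij: "f \<in> thompson_elements \<Longrightarrow> bij_betw f {0..1} {0..1}"
  unfolding bij_betw_def
  using strict_mono_on_imp_inj_on thompson_elements_image thompson_elements_mono by blast

lemma thompson_elements_0: assumes "f \<in> thompson_elements" shows "f 0 = 0"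
proof -
  obtain t where "t \<in> {0..1}" "f t = 0"
    using thompson_elements_image[OF assms] by (metis atLeastAtMost_iff imageE order_refl zero_le_one)
  then show ?thesis
    using thompson_elements_le_iff[OF assms, of 0 t] thompson_elements_in_unit[OF assms, of 0] by auto
qed

lemma thompson_elements_1: assumes "f \<in> thompson_elements" shows "f 1 = 1"
proof -
  obtain t where "t \<in> {0..1}" "f t = 1"
    using thompson_elements_image[OF assms] by (metis atLeastAtMost_iff imageE order_refl zero_le_one)
  then show ?thesis
    using thompson_elements_le_iff[OF assms, of t 1] thompson_elements_in_unit[OF assms, of 1] by auto
qed

text \<open>Going from 0 through the break points, let \<open>e\<close> be the last one before
  \<open>t\<close>. As \<open>e\<close> and \<open>f e\<close> are dyadic, so is the intercept
  \<open>c\<close> of the piece from \<open>e\<close> to \<open>t\<close>, and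
  \<open>2 powi k * x + c\<close> preserves and reflects dyadic points. This makes the break points
  of composites and inverses dyadic.\<close>

lemma thompson_elements_dyadic_iff:
  assumes "f \<in> thompson_elements" "t \<in> {0..1}"
  shows "f t \<in> dyadic_rationals \<longleftrightarrow> t \<in> dyadic_rationals"
proof -
  obtain D where D: "finite D" "D \<subseteq> dyadic_rationals" "affine_pieces D f"
    using thompson_elementsE assms(1) .
  \<comment> \<open>The point 0 is added so that some element of \<open>?E\<close> lies below every
    \<open>t > 0\<close>.\<close>
  let ?E = "insert 0 (D \<inter> {0..1})"
  show ?thesis
    using assms(2)
  proof (induction "card {e \<in> ?E. e < t}" arbitrary: t rule: less_induct)
    case less
    show ?case
    proof (cases "t = 0")
      case True
      then show ?thesis by (simp add: thompson_elements_0[OF assms(1)])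
    next
      case False
      with less.prems have t: "0 < t" "t \<le> 1" by auto
      let ?S = "{e \<in> ?E. e < t}"
      define e where "e = Max ?S"
      have S: "finite ?S" "?S \<noteq> {}"
        using D(1) t by auto
      then have e: "e \<in> ?S" "\<forall>x\<in>?S. x \<le> e"
        unfolding e_def by (rule Max_in, simp)
      have e01: "0 \<le> e" "e < t"
        using e by auto
      have "{x \<in> ?E. x < e} \<subset> ?S"
        using e by (auto simp: psubset_eq)
      then have IH: "f e \<in> dyadic_rationals \<longleftrightarrow> e \<in> dyadic_rationals"
        using less.hyps[of e] psubset_card_mono[OF S(1)] e01 t by auto
      have "{e<..<t} \<inter> D = {}"
      proof (rule ccontr)
        assume "{e<..<t} \<inter> D \<noteq> {}"
        then obtain x where x: "x \<in> D" "e < x" "x < t" by auto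
        with e01 t have "x \<in> ?S" by auto
        with e(2) x(2) show False by force
      qed
      then obtain k c where kc: "\<And>x. e \<le> x \<Longrightarrow> x \<le> t \<Longrightarrow> f x = 2 powi k * x + c"
        using affine_piecesE[OF D(3) e01] t by blast
      have "e \<in> dyadic_rationals"
        using e D(2) by auto
      moreover from this IH kc[of e] e01 have "c \<in> dyadic_rationals"
        using dyadic_rationals_diff[of "f e" "2 powi k * e"] dyadic_rationals_powi by auto
      ultimately show ?thesis
        using kc[of t] e01 by (simp add: dyadic_rationals_affine_iff)
    qed
  qed
qed

section \<open>Closure under composition and inversion, and the group structure\<close>

lemma thompson_elements_compose:
  assumes f: "f \<in> thompson_elements" and g: "g \<in> thompson_elements"
  shows "compose {0..1} f g \<in> thompson_elements"
proof -
  obtain D where D: "finite D" "D \<subseteq> dyadic_rationals" "affine_pieces D f"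
    using thompson_elementsE f .
  obtain E where E: "finite E" "E \<subseteq> dyadic_rationals" "affine_pieces E g"
    using thompson_elementsE g .
  note fg = thompson_elements_0[OF f] thompson_elements_0[OF g]
    thompson_elements_1[OF f] thompson_elements_1[OF g]
  \<comment> \<open>A composite can break where \<open>g\<close> breaks or where \<open>g\<close>
    hits a break point of \<open>f\<close>.\<close>
  let ?E = "E \<union> (g -` D \<inter> {0..1})"
  show ?thesis
  proof (rule thompson_elementsI)
    show "strict_mono_on {0..1} (compose {0..1} f g)"
    proof (rule strict_mono_onI)
      fix r s :: real
      assume "r \<in> {0..1}" "s \<in> {0..1}" "r < s"
      then show "compose {0..1} f g r < compose {0..1} f g s"
        using thompson_elements_in_unit[OF g] 
        by (auto simp: compose_eq thompson_elements_less_iff[OF f] thompson_elements_less_iff[OF g])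
    qed
    show "finite ?E"
      using D(1) E(1) thompson_elements_bij[OF g]
      by (auto intro: finite_vimage_IntI simp: bij_betw_def)
    show "?E \<subseteq> dyadic_rationals"
      using E(2) D(2) thompson_elements_dyadic_iff[OF g] by auto
    show "affine_pieces ?E (compose {0..1} f g)"
      unfolding affine_pieces_def
    proof (intro allI impI)
      fix a b :: real
      assume ab: "0 \<le> a \<and> a < b \<and> b \<le> 1 \<and> {a<..<b} \<inter> ?E = {}"
      then have "{a<..<b} \<inter> E = {}" by blast
      with ab obtain k c where kc: "\<And>t. a \<le> t \<Longrightarrow> t \<le> b \<Longrightarrow> g t = 2 powi k * t + c"
        using affine_piecesE[OF E(3), of a b] by metis
      have gab: "0 \<le> g a" "g a < g b" "g b \<le> 1"
        using thompson_elements_in_unit[OF g, of a] thompson_elements_in_unit[OF g, of b]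
          thompson_elements_less_iff[OF g, of a b] ab by auto
      have "{g a<..<g b} \<inter> D = {}"
      proof (rule ccontr)
        assume "{g a<..<g b} \<inter> D \<noteq> {}"
        then obtain y where y: "y \<in> D" "g a < y" "y < g b" by auto
        then obtain t where t: "t \<in> {0..1}" "y = g t"
          using thompson_elements_image[OF g] gab
          by (metis atLeastAtMost_iff imageE less_imp_le order_trans)
        then have "a < t" "t < b"
          using y ab thompson_elements_less_iff[OF g, of a t]
            thompson_elements_less_iff[OF g, of t b] by auto
        with y t ab show False by auto
      qed
      then obtain l d where ld: "\<And>t. g a \<le> t \<Longrightarrow> t \<le> g b \<Longrightarrow> f t = 2 powi l * t + d"
        using affine_piecesE[OF D(3) gab] by metis
      have "compose {0..1} f g t = 2 powi (l + k) * t + (2 powi l * c + d)" if t: "t \<in> {a..b}" for t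
      proof -
        have "g a \<le> g t" "g t \<le> g b"
          using thompson_elements_le_iff[OF g] t ab by auto
        then show ?thesis
          using t ab ld[of "g t"] kc[of t]
          by (simp add: compose_eq power_int_add algebra_simps)
      qed
      then show "\<exists>(k::int) c. \<forall>t\<in>{a..b}. compose {0..1} f g t = 2 powi k * t + c"
        by blast
    qed
  qed (simp_all add: fg compose_eq)
qed

lemma thompson_elements_inverse:
  assumes f: "f \<in> thompson_elements"
  shows "restrict (inv_into {0..1} f) {0..1} \<in> thompson_elements"
    (is "?g \<in> _")
proof -
  obtain D where D: "finite D" "D \<subseteq> dyadic_rationals" "affine_pieces D f"
    using thompson_elementsE f .
  note bij = thompson_elements_bij[OF f]
  have fg: "f (?g t) = t" "?g t \<in> {0..1}" if "t \<in> {0..1}" for t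
    using that bij_betw_inv_into_right[OF bij] inv_into_into[of t f "{0..1}"]
      thompson_elements_image[OF f] by auto
  \<comment> \<open>The inverse breaks at the images of the break points of \<open>f\<close>; on
    each piece it is the inverse affine map, of slope \<open>2 powi (- k)\<close>.\<close>
  let ?D = "f ` (D \<inter> {0..1})"
  show ?thesis
  proof (rule thompson_elementsI)
    show "?g 0 = 0" "?g 1 = 1"
      using fg[of 0] fg[of 1] thompson_elements_0[OF f] thompson_elements_1[OF f]
        thompson_elements_eq_iff[OF f, of "?g 0" 0] thompson_elements_eq_iff[OF f, of "?g 1" 1]
      by auto
    show "strict_mono_on {0..1} ?g"
    proof (rule strict_mono_onI)
      fix r s :: real
      assume "r \<in> {0..1}" "s \<in> {0..1}" "r < s"
      then show "?g r < ?g s"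
        using fg[of r] fg[of s] thompson_elements_less_iff[OF f, of "?g r" "?g s"] by simp
    qed
    show "finite ?D"
      using D(1) by simp
    show "?D \<subseteq> dyadic_rationals"
      using D(2) thompson_elements_dyadic_iff[OF f] by auto
    show "affine_pieces ?D ?g"
      unfolding affine_pieces_def
    proof (intro allI impI)
      fix a b :: real
      assume ab: "0 \<le> a \<and> a < b \<and> b \<le> 1 \<and> {a<..<b} \<inter> ?D = {}"
      have g_le: "?g s \<le> ?g t \<longleftrightarrow> s \<le> t" "?g s < ?g t \<longleftrightarrow> s < t"
        if "s \<in> {0..1}" "t \<in> {0..1}" for s t
        using thompson_elements_le_iff[OF f, of "?g s" "?g t"]
          thompson_elements_less_iff[OF f, of "?g s" "?g t"] fg[OF that(1)] fg[OF that(2)] by auto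
      have ab': "0 \<le> ?g a" "?g a < ?g b" "?g b \<le> 1"
        using fg[of a] fg[of b] g_le[of a b] ab by auto
      have "{?g a<..<?g b} \<inter> D = {}"
      proof (rule ccontr)
        assume "{?g a<..<?g b} \<inter> D \<noteq> {}"
        then obtain y where y: "y \<in> D" "?g a < y" "y < ?g b" by auto
        then have "a < f y" "f y < b" "y \<in> {0..1}"
          using thompson_elements_less_iff[OF f, of "?g a" y] fg[of a] fg[of b]
            thompson_elements_less_iff[OF f, of y "?g b"] ab ab' by auto
        with y ab show False by auto
      qed
      then obtain k c where kc: "\<And>t. ?g a \<le> t \<Longrightarrow> t \<le> ?g b \<Longrightarrow> f t = 2 powi k * t + c"
        using affine_piecesE[OF D(3) ab'] by metis
      have "?g t = 2 powi (- k) * t + (- (2 powi (- k) * c))" if t: "t \<in> {a..b}" for t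
      proof -
        have "?g a \<le> ?g t" "?g t \<le> ?g b" and t01: "t \<in> {0..1}"
          using g_le(1)[of a t] g_le(1)[of t b] t ab by auto
        then have "t = 2 powi k * ?g t + c"
          using kc[of "?g t"] fg(1)[OF t01] by simp
        then have "2 powi (- k) * t = 2 powi (- k) * (2 powi k * ?g t + c)"
          by simp
        also have "\<dots> = ?g t + 2 powi (- k) * c"
          by (simp add: power_int_minus algebra_simps)
        finally show ?thesis by simp
      qed
      then show "\<exists>(k::int) c. \<forall>t\<in>{a..b}. ?g t = 2 powi k * t + c"
        by blast
    qed
  qed simp
qed

lemma carrier_ThompsonF [simp]: "carrier ThompsonF = thompson_elements"
  by (simp add: ThompsonF_def)

lemma thompson_elements_id: "(\<lambda>t\<in>{0..1}. t) \<in> thompson_elements"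
  by (rule thompson_elementsI[of _ "{}"])
    (auto simp: affine_pieces_def strict_mono_on_def intro!: exI[of _ "0::int"] exI[of _ "0::real"])

lemma subgroup_thompson_elements: "subgroup thompson_elements (BijGroup {0..1})"
proof -
  interpret B: group "BijGroup {0..1::real}"
    by (rule group_BijGroup)
  have Bij: "f \<in> Bij {0..1}" if "f \<in> thompson_elements" for f
    using thompson_elements_extensional thompson_elements_bij that by (auto simp: Bij_def)
  show ?thesis
  proof (rule B.subgroupI)
    show "thompson_elements \<subseteq> carrier (BijGroup {0..1})"
      using Bij by (auto simp: BijGroup_def)
    show "thompson_elements \<noteq> {}"
      using thompson_elements_id by blast
    show "inv\<^bsub>BijGroup {0..1}\<^esub> f \<in> thompson_elements" if "f \<in> thompson_elements" for f
      using thompson_elements_inverse[OF that] by (simp add: inv_BijGroup[OF Bij[OF that]])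
    show "f \<otimes>\<^bsub>BijGroup {0..1}\<^esub> g \<in> thompson_elements"
      if "f \<in> thompson_elements" "g \<in> thompson_elements" for f g
      using thompson_elements_compose[OF that] Bij that by (simp add: BijGroup_def)
  qed
qed

lemma group_ThompsonF: "group ThompsonF"
  unfolding ThompsonF_def
  using subgroup.subgroup_is_group[OF subgroup_thompson_elements group_BijGroup] .

lemma ThompsonF_mult:
  assumes "f \<in> thompson_elements" "g \<in> thompson_elements"
  shows "f \<otimes>\<^bsub>ThompsonF\<^esub> g = compose {0..1} f g"
  using assms thompson_elements_extensional thompson_elements_bij
  by (auto simp: ThompsonF_def BijGroup_def Bij_def)

lemma ThompsonF_mult_apply:
  assumes "f \<in> thompson_elements" "g \<in> thompson_elements" "t \<in> {0..1}"
  shows "(f \<otimes>\<^bsub>ThompsonF\<^esub> g) t = f (g t)"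
  using assms by (simp add: ThompsonF_mult compose_eq)

lemma ThompsonF_one: "\<one>\<^bsub>ThompsonF\<^esub> = (\<lambda>t\<in>{0..1}. t)"
  by (simp add: ThompsonF_def BijGroup_def)

lemma thompson_elements_eqI:
  assumes "f \<in> thompson_elements" "g \<in> thompson_elements" "\<And>t. t \<in> {0..1} \<Longrightarrow> f t = g t"
  shows "f = g"
  using extensionalityI[OF assms(1,2)[THEN thompson_elements_extensional]] assms(3) .

section \<open>Supports and the behaviour near the endpoints\<close>

lemma ThompsonF_inv_closed: "f \<in> thompson_elements \<Longrightarrow> inv\<^bsub>ThompsonF\<^esub> f \<in> thompson_elements"
  using group.inv_closed[OF group_ThompsonF] by simp

lemma ThompsonF_mult_closed:
  "f \<in> thompson_elements \<Longrightarrow> g \<in> thompson_elements \<Longrightarrow> f \<otimes>\<^bsub>ThompsonF\<^esub> g \<in> thompson_elements"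
  using monoid.m_closed[OF group.is_monoid[OF group_ThompsonF]] by simp

lemma ThompsonF_apply_inv:
  assumes "f \<in> thompson_elements" "t \<in> {0..1}"
  shows "f ((inv\<^bsub>ThompsonF\<^esub> f) t) = t"
proof -
  have "(f \<otimes>\<^bsub>ThompsonF\<^esub> inv\<^bsub>ThompsonF\<^esub> f) t = t"
    using group.r_inv[OF group_ThompsonF, of f] assms by (simp add: ThompsonF_one)
  then show ?thesis
    using assms by (simp add: ThompsonF_mult_apply ThompsonF_inv_closed)
qed

section \<open>Supports, commutation and conjugation\<close>

text \<open>Each map sends its own support into itself, and the other map is the identity
  there.\<close>

lemma thompson_disjoint_supp_commute:
  assumes f: "f \<in> thompson_elements" and g: "g \<in> thompson_elements" and "supp f \<inter> supp g = {}"
  shows "f \<otimes>\<^bsub>ThompsonF\<^esub> g = g \<otimes>\<^bsub>ThompsonF\<^esub> f"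
proof (rule thompson_elements_eqI)
  fix t :: real
  assume t: "t \<in> {0..1}"
  have fix_f: "f s = s" if "s \<in> supp g" for s
    using that assms(3) by (auto simp: supp_def)
  have fix_g: "g s = s" if "s \<in> supp f" for s
    using that assms(3) by (auto simp: supp_def)
  have "f (g t) = g (f t)"
  proof (cases "t \<in> supp f")
    case True
    then have "f t \<in> supp f"
      using t thompson_elements_in_unit[OF f t] thompson_elements_eq_iff[OF f, of "f t" t]
      by (simp add: supp_def)
    with True show ?thesis
      by (simp add: fix_g)
  next
    case False
    then have "f t = t"
      using t by (simp add: supp_def)
    moreover have "g t = t \<or> g t \<in> supp g"
      using t thompson_elements_in_unit[OF g t] thompson_elements_eq_iff[OF g, of "g t" t]
      by (auto simp: supp_def)
    ultimately show ?thesis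
      using fix_f by auto
  qed
  then show "(f \<otimes>\<^bsub>ThompsonF\<^esub> g) t = (g \<otimes>\<^bsub>ThompsonF\<^esub> f) t"
    using t f g by (simp add: ThompsonF_mult_apply)
qed (use f g in \<open>simp_all add: ThompsonF_mult_closed\<close>)

lemma thompson_supp_conj:
  assumes f: "f \<in> thompson_elements" and g: "g \<in> thompson_elements"
  shows "supp (g \<otimes>\<^bsub>ThompsonF\<^esub> f \<otimes>\<^bsub>ThompsonF\<^esub> inv\<^bsub>ThompsonF\<^esub> g) = g ` supp f"
proof -
  let ?g' = "inv\<^bsub>ThompsonF\<^esub> g"
  let ?c = "g \<otimes>\<^bsub>ThompsonF\<^esub> f \<otimes>\<^bsub>ThompsonF\<^esub> ?g'"
  have c: "?c (g s) = g (f s)" if "s \<in> {0..1}" for s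
  proof -
    have gs: "g s \<in> {0..1}"
      using thompson_elements_in_unit[OF g that] .
    then have "?g' (g s) = s"
      using thompson_elements_in_unit[OF ThompsonF_inv_closed[OF g] gs] that
        ThompsonF_apply_inv[OF g gs] thompson_elements_eq_iff[OF g] by blast
    then show ?thesis
      using f g gs that
      by (simp add: ThompsonF_mult_apply ThompsonF_mult_closed ThompsonF_inv_closed)
  qed
  have *: "g s \<in> supp ?c \<longleftrightarrow> s \<in> supp f" if s: "s \<in> {0..1}" for s
    using s c[OF s] thompson_elements_in_unit[OF g s] thompson_elements_in_unit[OF f s]
      thompson_elements_eq_iff[OF g, of "f s" s] by (simp add: supp_def)
  show ?thesis
  proof
    show "g ` supp f \<subseteq> supp ?c"
      using * by (auto simp: supp_def)
    show "supp ?c \<subseteq> g ` supp f"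
    proof
      fix t
      assume t: "t \<in> supp ?c"
      then have "t \<in> g ` {0..1}"
        using thompson_elements_image[OF g] by (simp add: supp_def)
      with t * show "t \<in> g ` supp f"
        by blast
    qed
  qed
qed

lemma thompson_conj_commute:
  assumes "f \<in> thompson_elements" "g \<in> thompson_elements" "h \<in> thompson_elements"
    and "g ` supp f \<inter> supp h = {}"
  shows "(g \<otimes>\<^bsub>ThompsonF\<^esub> f \<otimes>\<^bsub>ThompsonF\<^esub> inv\<^bsub>ThompsonF\<^esub> g) \<otimes>\<^bsub>ThompsonF\<^esub> h =
    h \<otimes>\<^bsub>ThompsonF\<^esub> (g \<otimes>\<^bsub>ThompsonF\<^esub> f \<otimes>\<^bsub>ThompsonF\<^esub> inv\<^bsub>ThompsonF\<^esub> g)"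
  using assms by (intro thompson_disjoint_supp_commute)
    (simp_all add: thompson_supp_conj ThompsonF_mult_closed ThompsonF_inv_closed)

text \<open>From \<open>f (g t) = g (f t)\<close> and injectivity of \<open>g\<close>. It is the
  obstruction used below: an element commuting with \<open>f\<close> cannot move the support of a
  nontrivial \<open>f\<close> off itself.\<close>

lemma thompson_commute_supp:
  assumes f: "f \<in> thompson_elements" and g: "g \<in> thompson_elements"
    and comm: "f \<otimes>\<^bsub>ThompsonF\<^esub> g = g \<otimes>\<^bsub>ThompsonF\<^esub> f"
    and t: "t \<in> supp f"
  shows "g t \<in> supp f"
proof -
  have t01: "t \<in> {0..1}" "f t \<noteq> t"
    using t by (auto simp: supp_def)
  have "f (g t) = g (f t)"
    using fun_cong[OF comm, of t] f g t01 by (simp add: ThompsonF_mult_apply)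
  then show ?thesis
    using t01 thompson_elements_in_unit[OF g] thompson_elements_in_unit[OF f]
      thompson_elements_eq_iff[OF g, of "f t" t] by (simp add: supp_def)
qed

lemma thompson_supp_empty:
  assumes "f \<in> thompson_elements" "supp f = {}"
  shows "f = \<one>\<^bsub>ThompsonF\<^esub>"
  unfolding ThompsonF_one
  using assms by (intro thompson_elements_eqI thompson_elements_id) (auto simp: supp_def)

text \<open>Conjugation by the reflection of the unit interval. It respects products and exchanges
  the endpoints, so that results near 0 carry over to 1.\<close>

definition thompson_flip :: "(real \<Rightarrow> real) \<Rightarrow> real \<Rightarrow> real" where
  "thompson_flip f = (\<lambda>t\<in>{0..1}. 1 - f (1 - t))"

lemma thompson_flip_closed:
  assumes f: "f \<in> thompson_elements"
  shows "thompson_flip f \<in> thompson_elements"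
proof -
  obtain D where D: "finite D" "D \<subseteq> dyadic_rationals" "affine_pieces D f"
    using thompson_elementsE f .
  show ?thesis
  proof (rule thompson_elementsI)
    show "strict_mono_on {0..1} (thompson_flip f)"
      by (rule strict_mono_onI) (simp add: thompson_flip_def thompson_elements_less_iff[OF f])
    show "finite ((\<lambda>t. 1 - t) ` D)"
      using D(1) by simp
    show "(\<lambda>t. 1 - t) ` D \<subseteq> dyadic_rationals"
      using D(2) by (auto intro: dyadic_rationals_diff)
    show "affine_pieces ((\<lambda>t. 1 - t) ` D) (thompson_flip f)"
      unfolding affine_pieces_def
    proof (intro allI impI)
      fix a b :: real
      assume ab: "0 \<le> a \<and> a < b \<and> b \<le> 1 \<and> {a<..<b} \<inter> (\<lambda>t. 1 - t) ` D = {}"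
      have "{1 - b<..<1 - a} \<inter> D = {}"
      proof (rule ccontr)
        assume "{1 - b<..<1 - a} \<inter> D \<noteq> {}"
        then obtain x where "x \<in> D" "1 - b < x" "x < 1 - a" by auto
        then have "1 - x \<in> {a<..<b} \<inter> (\<lambda>t. 1 - t) ` D" by auto
        with ab show False by blast
      qed
      then obtain k c where kc: "\<And>t. 1 - b \<le> t \<Longrightarrow> t \<le> 1 - a \<Longrightarrow> f t = 2 powi k * t + c"
        using affine_piecesE[OF D(3), of "1 - b" "1 - a"] ab by auto
      have "thompson_flip f t = 2 powi k * t + (1 - 2 powi k - c)" if "t \<in> {a..b}" for t
        using that ab kc[of "1 - t"] by (simp add: thompson_flip_def algebra_simps)
      then show "\<exists>(k::int) c. \<forall>t\<in>{a..b}. thompson_flip f t = 2 powi k * t + c"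
        by blast
    qed
  qed (simp_all add: thompson_flip_def thompson_elements_0[OF f] thompson_elements_1[OF f])
qed

lemma thompson_flip_mult:
  assumes f: "f \<in> thompson_elements" and g: "g \<in> thompson_elements"
  shows "thompson_flip (f \<otimes>\<^bsub>ThompsonF\<^esub> g) = thompson_flip f \<otimes>\<^bsub>ThompsonF\<^esub> thompson_flip g"
proof (rule thompson_elements_eqI)
  fix t :: real
  assume t: "t \<in> {0..1}"
  then have "g (1 - t) \<in> {0..1}"
    using thompson_elements_in_unit[OF g] by simp
  then show "thompson_flip (f \<otimes>\<^bsub>ThompsonF\<^esub> g) t = (thompson_flip f \<otimes>\<^bsub>ThompsonF\<^esub> thompson_flip g) t"
    using t f g by (simp add: thompson_flip_def ThompsonF_mult_apply
        thompson_flip_closed[unfolded thompson_flip_def])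
qed (use f g in \<open>simp_all add: thompson_flip_closed ThompsonF_mult_closed\<close>)

lemma supp_thompson_flip: "t \<in> supp (thompson_flip f) \<longleftrightarrow> 1 - t \<in> supp f"
  by (auto simp: supp_def thompson_flip_def)

section \<open>Germs at the endpoints and centralizers\<close>

lemma thompson_germ_0:
  assumes f: "f \<in> thompson_elements"
  obtains k :: int and b :: real where "0 < b" "b \<le> 1"
    "\<And>t. 0 \<le> t \<Longrightarrow> t \<le> b \<Longrightarrow> f t = 2 powi k * t"
proof -
  obtain D where D: "finite D" "affine_pieces D f"
    using thompson_elementsE f .
  obtain b where b: "0 < b" "b \<le> 1" "{0<..<b} \<inter> D = {}"
    using finite_gap_right[OF D(1), of 0 1] by auto
  obtain k c where kc: "\<And>t. 0 \<le> t \<Longrightarrow> t \<le> b \<Longrightarrow> f t = 2 powi k * t + c"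
    using affine_piecesE[OF D(2) _ b] by auto
  moreover have "c = 0"
    using kc[of 0] b thompson_elements_0[OF f] by simp
  ultimately show thesis
    using that[OF b(1,2), of k] by simp
qed

text \<open>
  Iterating a germ \<open>t \<mapsto> m t\<close> with \<open>m \<noteq> 1\<close> transports the linearity of a commuting element at 0 to
  the whole interval where \<open>h\<close> is linear, independently of the commuting element.
\<close>

lemma thompson_commute_linear:
  assumes h: "h \<in> thompson_elements" and b: "0 < b" "b \<le> 1"
    and m: "m > 0" "m \<noteq> 1" and lin: "\<And>t. 0 \<le> t \<Longrightarrow> t \<le> b \<Longrightarrow> h t = m * t"
    and g: "g \<in> thompson_elements" and comm: "g \<otimes>\<^bsub>ThompsonF\<^esub> h = h \<otimes>\<^bsub>ThompsonF\<^esub> g"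
  obtains k :: int where "\<And>t. 0 \<le> t \<Longrightarrow> t \<le> b \<Longrightarrow> 2 powi k * t \<le> b \<Longrightarrow> g t = 2 powi k * t"
proof -
  obtain k c where c: "0 < c" "c \<le> 1" and gk: "\<And>t. 0 \<le> t \<Longrightarrow> t \<le> c \<Longrightarrow> g t = 2 powi k * t"
    using thompson_germ_0[OF g] by metis
  have hj: "(h ^^ j) t \<in> {0..1}" if "t \<in> {0..1}" for j t
    using that by (induction j) (use thompson_elements_in_unit[OF h] in auto)
  have ghj: "g ((h ^^ j) t) = (h ^^ j) (g t)" if t: "t \<in> {0..1}" for j t
  proof (induction j)
    case (Suc j)
    have "g (h ((h ^^ j) t)) = h (g ((h ^^ j) t))"
      using fun_cong[OF comm, of "(h ^^ j) t"] hj[OF t] g h by (simp add: ThompsonF_mult_apply)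
    with Suc show ?case by simp
  qed simp
  have inj: "(h ^^ j) s = (h ^^ j) t \<Longrightarrow> s = t" if "s \<in> {0..1}" "t \<in> {0..1}" for j s t
  proof (induction j)
    case (Suc j)
    then show ?case
      using thompson_elements_eq_iff[OF h hj[OF that(1)] hj[OF that(2)]] by simp
  qed simp
  show thesis
  proof (rule that)
    fix t
    assume t: "0 \<le> t" "t \<le> b" "2 powi k * t \<le> b"
    have t01: "t \<in> {0..1}" and kt: "0 \<le> 2 powi k * t" "2 powi k * t \<in> {0..1}"
      using t b by auto
    have gt: "g t \<in> {0..1}"
      using thompson_elements_in_unit[OF g t01] .
    show "g t = 2 powi k * t"
    proof (cases "m < 1")
      \<comment> \<open>Here \<open>h\<close> contracts: a high iterate carries \<open>t\<close>
        into \<open>[0, c]\<close>, where \<open>g\<close> is known to be linear. As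
        \<open>t\<close> and \<open>2 powi k * t\<close> are at most \<open>b\<close>, the iterate
        is multiplication by \<open>m ^ j\<close> on both, and its injectivity yields the
        claim.\<close>
      case True
      have linj: "(h ^^ j) s = m ^ j * s" if "0 \<le> s" "s \<le> b" for j s
      proof (induction j)
        case (Suc j)
        have "m ^ j * s \<le> 1 * s"
          using True m that by (intro mult_right_mono power_le_one) auto
        then show ?case
          using Suc lin[of "m ^ j * s"] m that by simp
      qed simp
      obtain j where "m ^ j < c"
        using real_arch_pow_inv[OF c(1) True] by blast
      moreover have "m ^ j * t \<le> m ^ j * 1"
        using m t01 by (intro mult_left_mono) auto
      ultimately have "m ^ j * t \<le> c"
        by linarith
      then have "g (m ^ j * t) = 2 powi k * (m ^ j * t)"
        using gk[of "m ^ j * t"] m t by simp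
      then have "(h ^^ j) (g t) = (h ^^ j) (2 powi k * t)"
        using ghj[OF t01, of j] linj[of t j] linj[of "2 powi k * t" j] t kt
        by (simp add: mult.left_commute[of "m ^ j"])
      then show ?thesis
        using inj[OF gt kt(2)] by blast
    next
      case False
      then have m1: "1 < m"
        using m by simp
      have linj: "(h ^^ j) s = m ^ j * s" if "0 \<le> s" "m ^ j * s \<le> b" for j s
        using that(2)
      proof (induction j)
        case (Suc j)
        have "1 * (m ^ j * s) \<le> m * (m ^ j * s)"
          using m1 that by (intro mult_right_mono) auto
        then have "m ^ j * s \<le> b"
          using Suc.prems by (simp add: mult.assoc)
        then show ?case
          using Suc.IH lin[of "m ^ j * s"] m that by simp
      qed simp
      obtain j where j: "(1 / m) ^ j < c"
        using real_arch_pow_inv[OF c(1), of "1 / m"] m1 by auto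
      \<comment> \<open>Here \<open>h\<close> expands, so the argument runs forwards:
        \<open>s\<close> lies in the germ interval of \<open>g\<close>, and the iterate
        \<open>h ^^ j\<close> takes \<open>s\<close> to \<open>t\<close> and
        \<open>2 powi k * s\<close> to \<open>2 powi k * t\<close>. Linearity of \<open>h\<close>
        applies all along, because these end values do not exceed \<open>b\<close>.\<close>
      define s where "s = (1 / m) ^ j * t"
      have mjs: "m ^ j * s = t" and s: "0 \<le> s"
        using m t by (auto simp: s_def power_one_over)
      have "s \<le> (1 / m) ^ j * 1"
        unfolding s_def using m t01 by (intro mult_left_mono) auto
      with j s have "g s = 2 powi k * s"
        using gk[of s] by simp
      moreover have "s \<le> c" "s \<in> {0..1}"
        using \<open>s \<le> (1 / m) ^ j * 1\<close> j s c by auto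
      moreover have "(h ^^ j) s = t" "(h ^^ j) (2 powi k * s) = 2 powi k * t"
        using linj[of s j] linj[of "2 powi k * s" j] mjs s t
        by (auto simp: mult.left_commute[of "m ^ j"])
      ultimately show ?thesis
        using ghj[of s j] by simp
    qed
  qed
qed

text \<open>Near 0 a commuting \<open>g\<close> is multiplication by \<open>2 powi k\<close>. It
  fixes \<open>[0, e]\<close> if \<open>k = 0\<close>, pushes \<open>(e/2, e)\<close> below
  \<open>e/2\<close> if \<open>k < 0\<close> and beyond \<open>e\<close> if \<open>k > 0\<close>.
  The bound \<open>b\<close> is chosen from \<open>h\<close> alone, so that one \<open>e\<close>
  will serve a whole sequence of commuting elements.\<close>

lemma thompson_centralizer_near_0:
  assumes h: "h \<in> thompson_elements" and supp: "0 \<in> closure (supp h)"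
  obtains b where "0 < b"
    "\<And>g e. g \<in> thompson_elements \<Longrightarrow> g \<otimes>\<^bsub>ThompsonF\<^esub> h = h \<otimes>\<^bsub>ThompsonF\<^esub> g \<Longrightarrow> 0 < e \<Longrightarrow> e \<le> b \<Longrightarrow>
       supp g \<inter> {0..e} = {} \<or> g ` {e / 2<..<e} \<inter> {e / 2<..<e} = {}"
proof -
  obtain q b where b: "0 < b" "b \<le> 1" and hq: "\<And>t. 0 \<le> t \<Longrightarrow> t \<le> b \<Longrightarrow> h t = 2 powi q * t"
    using thompson_germ_0[OF h] by metis
  \<comment> \<open>With slope 1 at 0, \<open>h\<close> would be the identity on
    \<open>[0, b]\<close> and 0 would not be in the closure of its support.\<close>
  have "2 powi q \<noteq> (1 :: real)"
  proof
    assume "2 powi q = (1 :: real)"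
    with hq have "supp h \<subseteq> {b..}"
      by (auto simp: supp_def not_le[symmetric] intro: ccontr)
    then have "closure (supp h) \<subseteq> {b..}"
      by (simp add: closure_minimal)
    with supp b show False by auto
  qed
  show thesis
  proof (rule that[OF b(1)])
    fix g e
    assume g: "g \<in> thompson_elements" and "g \<otimes>\<^bsub>ThompsonF\<^esub> h = h \<otimes>\<^bsub>ThompsonF\<^esub> g"
      and e: "0 < e" "e \<le> b"
    then obtain k where k: "\<And>t. 0 \<le> t \<Longrightarrow> t \<le> b \<Longrightarrow> 2 powi k * t \<le> b \<Longrightarrow> g t = 2 powi k * t"
      using thompson_commute_linear[OF h b _ \<open>2 powi q \<noteq> 1\<close> hq] by auto
    consider "k = 0" | "k \<le> -1" | "k \<ge> 1"
      by linarith
    then show "supp g \<inter> {0..e} = {} \<or> g ` {e / 2<..<e} \<inter> {e / 2<..<e} = {}"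
    proof cases
      case 1
      then show ?thesis
        using k e by (auto simp: supp_def)
    next
      case 2
      then have "2 powi k \<le> (2 powi (-1) :: real)"
        by (intro power_int_increasing) auto
      then have "2 powi k * t \<le> e / 2" if "0 \<le> t" "t \<le> e" for t
        using mult_mono[of "2 powi k" "1 / 2" t e] that e by simp
      then have "\<not> e / 2 < g t" if "e / 2 < t" "t < e" for t
        using k[of t] that e by (smt (verit, best) field_sum_of_halves)
      then show ?thesis
        by auto
    next
      case 3
      then have *: "2 powi (- k) \<le> (2 powi (-1) :: real)"
        by (intro power_int_increasing) auto
      define s where "s = 2 powi (- k) * e"
      have s: "0 \<le> s" "s \<le> e / 2" "2 powi k * s = e"
        using mult_right_mono[of "2 powi (- k)" "1 / 2" e] * e
        by (simp_all add: s_def power_int_minus field_simps)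
      then have "g s = e"
        using k[of s] e by simp
      then have "\<not> g t < e" if "e / 2 < t" "t < e" for t
        using thompson_elements_le_iff[OF g, of s t] s that e b by simp
      then show ?thesis
        by auto
    qed
  qed
qed

lemma thompson_centralizer_near_1:
  assumes h: "h \<in> thompson_elements" and supp: "1 \<in> closure (supp h)"
  obtains b where "0 < b"
    "\<And>g e. g \<in> thompson_elements \<Longrightarrow> g \<otimes>\<^bsub>ThompsonF\<^esub> h = h \<otimes>\<^bsub>ThompsonF\<^esub> g \<Longrightarrow> 0 < e \<Longrightarrow> e \<le> b \<Longrightarrow> e \<le> 1 \<Longrightarrow>
       supp g \<inter> {1 - e..1} = {} \<or> g ` {1 - e<..<1 - e / 2} \<inter> {1 - e<..<1 - e / 2} = {}"
proof -
  \<comment> \<open>Reflection reduces the claim to the behaviour at 0; the bound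
    \<open>e \<le> 1\<close> keeps the reflected interval inside the unit interval.\<close>
  have "0 \<in> closure (supp (thompson_flip h))"
    unfolding closure_approachable
  proof (intro allI impI)
    fix e :: real
    assume "0 < e"
    with supp obtain y where "y \<in> supp h" "dist y 1 < e"
      unfolding closure_approachable by blast
    then show "\<exists>y\<in>supp (thompson_flip h). dist y 0 < e"
      by (intro bexI[of _ "1 - y"]) (auto simp: supp_thompson_flip dist_real_def)
  qed
  then obtain b where b: "0 < b" and *: "\<And>g e. g \<in> thompson_elements \<Longrightarrow>
      g \<otimes>\<^bsub>ThompsonF\<^esub> thompson_flip h = thompson_flip h \<otimes>\<^bsub>ThompsonF\<^esub> g \<Longrightarrow> 0 < e \<Longrightarrow> e \<le> b \<Longrightarrow>
       supp g \<inter> {0..e} = {} \<or> g ` {e / 2<..<e} \<inter> {e / 2<..<e} = {}"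
    using thompson_centralizer_near_0[OF thompson_flip_closed[OF h]] by metis
  show thesis
  proof (rule that[OF b])
    fix g e
    assume g: "g \<in> thompson_elements" and comm: "g \<otimes>\<^bsub>ThompsonF\<^esub> h = h \<otimes>\<^bsub>ThompsonF\<^esub> g"
      and e: "0 < e" "e \<le> b" "e \<le> 1"
    have "thompson_flip g \<otimes>\<^bsub>ThompsonF\<^esub> thompson_flip h = thompson_flip h \<otimes>\<^bsub>ThompsonF\<^esub> thompson_flip g"
      using arg_cong[OF comm, of thompson_flip] g h by (simp add: thompson_flip_mult)
    from *[OF thompson_flip_closed[OF g] this e(1,2)]
    show "supp g \<inter> {1 - e..1} = {} \<or> g ` {1 - e<..<1 - e / 2} \<inter> {1 - e<..<1 - e / 2} = {}"
    proof
      assume "supp (thompson_flip g) \<inter> {0..e} = {}"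
      then have "1 - t \<notin> supp (thompson_flip g)" if "t \<in> {1 - e..1}" for t
        using that by auto
      then show ?thesis
        by (auto simp: supp_thompson_flip)
    next
      assume *: "thompson_flip g ` {e / 2<..<e} \<inter> {e / 2<..<e} = {}"
      have "g t \<notin> {1 - e<..<1 - e / 2}" if "t \<in> {1 - e<..<1 - e / 2}" for t
      proof -
        have "1 - t \<in> {e / 2<..<e}"
          using that by auto
        with * have "thompson_flip g (1 - t) \<notin> {e / 2<..<e}"
          by blast
        moreover have "thompson_flip g (1 - t) = 1 - g t"
          using that e by (auto simp: thompson_flip_def)
        ultimately show ?thesis
          by auto
      qed
      then show ?thesis
        by blast
    qed
  qed
qed

section \<open>Some elements of Thompson's group\<close>

text \<open>A copy of \<open>x0\<close> scaled to the interval from \<open>c\<close> to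
  \<open>c + L\<close> and extended by the identity. Both generators have this form, and so do the
  test elements with prescribed small support.\<close>

definition thompson_bump :: "real \<Rightarrow> real \<Rightarrow> real \<Rightarrow> real" where
  "thompson_bump c L = (\<lambda>t\<in>{0..1}.
     if t \<le> c then t
     else if t \<le> c + L / 2 then t / 2 + c / 2
     else if t \<le> c + 3 * L / 4 then t - L / 4
     else if t \<le> c + L then 2 * t - (c + L)
     else t)"

lemma x0_eq_thompson_bump: "x0 = thompson_bump 0 1"
  by (auto simp: x0_def thompson_bump_def fun_eq_iff restrict_def)

lemma x1_eq_thompson_bump: "x1 = thompson_bump (1 / 2) (1 / 2)"
  by (auto simp: x1_def thompson_bump_def fun_eq_iff restrict_def field_simps)

lemma thompson_bump_closed:
  assumes c: "c \<in> dyadic_rationals" "0 \<le> c" and L: "L \<in> dyadic_rationals" "0 < L"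
    and cL: "c + L \<le> 1"
  shows "thompson_bump c L \<in> thompson_elements"
proof -
  let ?D = "{c, c + L / 2, c + 3 * L / 4, c + L}"
  have half: "x / 2 \<in> dyadic_rationals" if "x \<in> dyadic_rationals" for x
    using dyadic_rationals_powi[OF that, of "-1"] by simp
  have D: "?D \<subseteq> dyadic_rationals"
  proof -
    have "L / 2 \<in> dyadic_rationals" "L / 4 \<in> dyadic_rationals"
      using half[OF L(1)] half[OF half[OF L(1)]] by auto
    moreover from dyadic_rationals_add[OF this] have "3 * L / 4 \<in> dyadic_rationals"
      by (simp add: field_simps)
    ultimately show ?thesis
      using c(1) L(1) by (auto intro: dyadic_rationals_add)
  qed
  show ?thesis
  proof (rule thompson_elementsI[OF _ _ _ _ _ D])
    show "thompson_bump c L 0 = 0" "thompson_bump c L 1 = 1"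
      using c L cL by (auto simp: thompson_bump_def)
    show "strict_mono_on {0..1} (thompson_bump c L)"
      by (rule strict_mono_onI) (use c L cL in \<open>auto simp: thompson_bump_def field_simps\<close>)
    show "affine_pieces ?D (thompson_bump c L)"
      unfolding affine_pieces_def
    proof (intro allI impI)
      fix a b :: real
      assume ab: "0 \<le> a \<and> a < b \<and> b \<le> 1 \<and> {a<..<b} \<inter> ?D = {}"
      then consider "b \<le> c" | "c \<le> a" "b \<le> c + L / 2" | "c + L / 2 \<le> a" "b \<le> c + 3 * L / 4"
        | "c + 3 * L / 4 \<le> a" "b \<le> c + L" | "c + L \<le> a"
        by fastforce
      then show "\<exists>(k::int) d. \<forall>t\<in>{a..b}. thompson_bump c L t = 2 powi k * t + d"
      proof cases
        case 1
        then show ?thesis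
          using ab by (intro exI[of _ 0]) (auto simp: thompson_bump_def)
      next
        case 2
        then show ?thesis
          using ab L by (intro exI[of _ "-1"] exI[of _ "c / 2"]) (auto simp: thompson_bump_def)
      next
        case 3
        then show ?thesis
          using ab L by (intro exI[of _ 0] exI[of _ "- (L / 4)"]) (auto simp: thompson_bump_def)
      next
        case 4
        then show ?thesis
          using ab L by (intro exI[of _ 1] exI[of _ "- (c + L)"]) (auto simp: thompson_bump_def)
      next
        case 5
        then show ?thesis
          using ab L by (intro exI[of _ 0] exI[of _ 0]) (auto simp: thompson_bump_def)
      qed
    qed
  qed (simp_all add: thompson_bump_def)
qed

lemma supp_thompson_bump:
  assumes "0 \<le> c" "0 < L" "c + L \<le> 1"
  shows "supp (thompson_bump c L) = {c<..<c + L}"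
  using assms by (auto simp: supp_def thompson_bump_def split: if_splits)

lemma x0_closed: "x0 \<in> thompson_elements"
  unfolding x0_eq_thompson_bump by (rule thompson_bump_closed) auto

lemma x1_closed: "x1 \<in> thompson_elements"
  unfolding x1_eq_thompson_bump
  using dyadic_rationals_powi[of 1 "-1"] by (intro thompson_bump_closed) auto

lemma ThompsonF_pow_apply:
  assumes "f \<in> thompson_elements" "t \<in> {0..1}"
  shows "(f [^]\<^bsub>ThompsonF\<^esub> m) t = (f ^^ m) t \<and> f [^]\<^bsub>ThompsonF\<^esub> m \<in> thompson_elements"
proof -
  interpret F: group ThompsonF by (rule group_ThompsonF)
  have closed: "f [^]\<^bsub>ThompsonF\<^esub> m \<in> thompson_elements" for m :: nat
    using F.nat_pow_closed[of f m] assms by simp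
  have "(f [^]\<^bsub>ThompsonF\<^esub> m) t = (f ^^ m) t"
  proof (induction m)
    case (Suc m)
    have "f [^]\<^bsub>ThompsonF\<^esub> Suc m = f \<otimes>\<^bsub>ThompsonF\<^esub> f [^]\<^bsub>ThompsonF\<^esub> m"
      using F.nat_pow_Suc2[of f m] assms by simp
    with Suc show ?case
      using assms closed by (simp add: ThompsonF_mult_apply del: F.nat_pow_Suc)
  qed (use assms in \<open>simp add: ThompsonF_one\<close>)
  with closed show ?thesis by simp
qed

text \<open>Every interior point is moved down by \<open>x0\<close>, so some power takes
  \<open>1 - e\<close> below \<open>e\<close>; by monotonicity it takes the whole interval
  there.\<close>

lemma thompson_displace:
  assumes e: "0 < e"
  obtains f where "f \<in> thompson_elements" "f ` {e..1 - e} \<inter> {e..1 - e} = {}"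
proof (cases "e \<le> 1 - e")
  case False
  then show thesis
    using that[OF x0_closed] by simp
next
  case True
  \<comment> \<open>On \<open>[e, 1 - e]\<close> the map \<open>x0\<close> lowers \<open>s\<close>
    by \<open>s / 2\<close>, by \<open>1 / 4\<close> or by \<open>1 - s\<close>, in each case by at
    least \<open>?d\<close>. Iterates that never dropped below \<open>e\<close> would thus decrease
    without bound.\<close>
  let ?t = "1 - e" and ?d = "min (e / 2) (1 / 4)"
  have "\<exists>m. (x0 ^^ m) ?t < e"
  proof (rule ccontr)
    assume "\<not> ?thesis"
    then have ge: "e \<le> (x0 ^^ m) ?t" for m
      by (simp add: not_less)
    have le: "(x0 ^^ m) ?t \<le> ?t - real m * ?d" for m
    proof (induction m)
      case (Suc m)
      let ?s = "(x0 ^^ m) ?t"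
      have "0 \<le> real m * ?d"
        using e by simp
      then have "e \<le> ?s" "?s \<le> 1 - e"
        using ge[of m] Suc by linarith+
      then have "x0 ?s \<le> ?s - ?d"
        using e by (auto simp: x0_def)
      with Suc show ?case
        by (simp add: algebra_simps)
    qed simp
    obtain m :: nat where "1 < real m * ?d"
      using ex_less_of_nat_mult[of ?d 1] e by auto
    with le[of m] ge[of m] e show False
      by linarith
  qed
  then obtain m where m: "(x0 ^^ m) ?t < e" by blast
  let ?f = "x0 [^]\<^bsub>ThompsonF\<^esub> m"
  have f: "?f \<in> thompson_elements" "?f ?t < e"
    using ThompsonF_pow_apply[OF x0_closed, of ?t m] m e True by auto
  have "\<not> e \<le> ?f t" if "t \<in> {e..1 - e}" for t
    using thompson_elements_le_iff[OF f(1), of t ?t] f(2) that e by auto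
  then have "?f ` {e..1 - e} \<inter> {e..1 - e} = {}"
    by auto
  with f(1) show thesis
    by (rule that)
qed

section \<open>Words and presentations\<close>

lemma gwords_simps [simp]:
  "[] \<in> gwords X"
  "(x, s) # w \<in> gwords X \<longleftrightarrow> x \<in> X \<and> w \<in> gwords X"
  "u @ v \<in> gwords X \<longleftrightarrow> u \<in> gwords X \<and> v \<in> gwords X"
  by (auto simp: gwords_def)

definition word_inverse :: "'x gword \<Rightarrow> 'x gword" where
  "word_inverse w = rev (map (\<lambda>(x, s). (x, \<not> s)) w)"

lemma word_inverse_simps [simp]:
  "word_inverse [] = []"
  "word_inverse ((x, s) # w) = word_inverse w @ [(x, \<not> s)]"
  by (simp_all add: word_inverse_def)

lemma word_inverse_gwords [simp]: "w \<in> gwords X \<Longrightarrow> word_inverse w \<in> gwords X"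
  by (induction w) auto

text \<open>Letters of any type with arbitrary values, so that one evaluation serves presentations
  and, with \<open>(!) S\<close> for \<open>e\<close>, marked groups.\<close>

fun word_eval :: "('k, 'm) monoid_scheme \<Rightarrow> ('x \<Rightarrow> 'k) \<Rightarrow> 'x gword \<Rightarrow> 'k" where
  "word_eval K e [] = \<one>\<^bsub>K\<^esub>"
| "word_eval K e ((x, s) # w) = (if s then e x else inv\<^bsub>K\<^esub> e x) \<otimes>\<^bsub>K\<^esub> word_eval K e w"

lemma word_value_eq_word_eval: "word_value (G, S) w = word_eval G ((!) S) w"
  by (induction w) auto

context group
begin

lemma word_eval_closed [simp]:
  assumes "e \<in> X \<rightarrow> carrier G" "w \<in> gwords X"
  shows "word_eval G e w \<in> carrier G"
  using assms(2) by (induction w) (use assms(1) in \<open>auto simp: Pi_iff\<close>)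

lemma word_eval_append:
  assumes "e \<in> X \<rightarrow> carrier G" "u \<in> gwords X" "v \<in> gwords X"
  shows "word_eval G e (u @ v) = word_eval G e u \<otimes> word_eval G e v"
  using assms(2)
proof (induction u)
  case Nil
  then show ?case
    using assms by simp
next
  case (Cons a u)
  obtain x s where [simp]: "a = (x, s)" by fastforce
  have "e x \<in> carrier G"
    using assms(1) Cons.prems by auto
  then show ?case
    using Cons assms by (simp add: m_assoc)
qed

lemma word_eval_word_inverse:
  assumes "e \<in> X \<rightarrow> carrier G" "w \<in> gwords X"
  shows "word_eval G e (word_inverse w) = inv (word_eval G e w)"
  using assms(2)
proof (induction w)
  case (Cons a w)
  obtain x s where [simp]: "a = (x, s)" by fastforce
  have "e x \<in> carrier G"
    using assms(1) Cons.prems by auto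
  then show ?case
    using Cons assms by (simp add: word_eval_append[of e X] inv_mult_group)
qed simp

end

section \<open>Presented groups and von Dyck's theorem\<close>

lemma presentation_rel_gwords:
  assumes "(u, v) \<in> presentation_rel X R"
  shows "u \<in> gwords X" "v \<in> gwords X"
  using assms by (induction rule: presentation_rel.induct) auto

lemma equiv_presentation_rel: "equiv (gwords X) (presentation_rel X R)"
proof (rule equivI)
  show "presentation_rel X R \<subseteq> gwords X \<times> gwords X"
    using presentation_rel_gwords[of _ _ X R] by auto
  show "refl_on (gwords X) (presentation_rel X R)"
    by (simp add: refl_on_def presentation_rel.refl)
  show "sym (presentation_rel X R)"
    by (auto intro: symI presentation_rel.sym)
  show "trans (presentation_rel X R)"
    by (auto intro: transI presentation_rel.trans)
qed

lemma presentation_rel_append_left: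
  assumes "(u, v) \<in> presentation_rel X R" "w \<in> gwords X"
  shows "(w @ u, w @ v) \<in> presentation_rel X R"
  using assms
proof (induction rule: presentation_rel.induct)
  case (cancel u v x s)
  then show ?case
    using presentation_rel.cancel[of "w @ u" X v x s R] by simp
next
  case (relator u v r)
  then show ?case
    using presentation_rel.relator[of "w @ u" X v r R] by simp
qed (auto intro: presentation_rel.refl presentation_rel.sym presentation_rel.trans)

lemma presentation_rel_append_right:
  assumes "(u, v) \<in> presentation_rel X R" "w \<in> gwords X"
  shows "(u @ w, v @ w) \<in> presentation_rel X R"
  using assms
proof (induction rule: presentation_rel.induct)
  case (cancel u v x s)
  then show ?case
    using presentation_rel.cancel[of u X "v @ w" x s R] by simp
next
  case (relator u v r)
  then show ?case
    using presentation_rel.relator[of u X "v @ w" r R] by simp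
qed (auto intro: presentation_rel.refl presentation_rel.sym presentation_rel.trans)

lemma presentation_rel_append:
  assumes "(u, u') \<in> presentation_rel X R" "(v, v') \<in> presentation_rel X R"
  shows "(u @ v, u' @ v') \<in> presentation_rel X R"
proof (rule presentation_rel.trans)
  show "(u @ v, u' @ v) \<in> presentation_rel X R"
    using presentation_rel_append_right[OF assms(1)] presentation_rel_gwords[OF assms(2)] by simp
  show "(u' @ v, u' @ v') \<in> presentation_rel X R"
    using presentation_rel_append_left[OF assms(2)] presentation_rel_gwords[OF assms(1)] by simp
qed

lemma presentation_rel_word_inverse:
  assumes "w \<in> gwords X"
  shows "(word_inverse w @ w, []) \<in> presentation_rel X R"
  using assms
proof (induction w)
  case Nil
  then show ?case by (simp add: presentation_rel.refl)
next
  case (Cons a w)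
  obtain x s where [simp]: "a = (x, s)" by fastforce
  have "(word_inverse w @ [(x, \<not> s), (x, \<not> \<not> s)] @ w, word_inverse w @ w) \<in> presentation_rel X R"
    using Cons.prems by (intro presentation_rel.cancel) auto
  then show ?case
    using Cons presentation_rel.trans by auto
qed

lemma presentation_class_eq_iff:
  assumes "u \<in> gwords X" "v \<in> gwords X"
  shows "presentation_rel X R `` {u} = presentation_rel X R `` {v} \<longleftrightarrow>
    (u, v) \<in> presentation_rel X R"
  using eq_equiv_class_iff[OF equiv_presentation_rel assms] .

text \<open>The relation is a congruence for concatenation, so all members of the union defining the
  product are the same class.\<close>

lemma presented_group_mult:
  assumes "u \<in> gwords X" "v \<in> gwords X"
  shows "presentation_rel X R `` {u} \<otimes>\<^bsub>presented_group X R\<^esub> presentation_rel X R `` {v} =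
    presentation_rel X R `` {u @ v}"
proof -
  have *: "presentation_rel X R `` {u' @ v'} = presentation_rel X R `` {u @ v}"
    if "u' \<in> presentation_rel X R `` {u}" "v' \<in> presentation_rel X R `` {v}" for u' v'
    using that assms presentation_rel_append[of u' u X R v' v] presentation_rel.sym
      presentation_rel_gwords[of u u' X R] presentation_rel_gwords[of v v' X R]
    by (subst presentation_class_eq_iff) auto
  have "presentation_rel X R `` {u} \<noteq> {}" "presentation_rel X R `` {v} \<noteq> {}"
    using assms by (auto intro: presentation_rel.refl)
  moreover have "presentation_rel X R `` {u} \<otimes>\<^bsub>presented_group X R\<^esub> presentation_rel X R `` {v} =
      (\<Union>u'\<in>presentation_rel X R `` {u}. \<Union>v'\<in>presentation_rel X R `` {v}.
        presentation_rel X R `` {u @ v})"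
    unfolding presented_group_def monoid.simps by (intro SUP_cong HOL.refl *)
  ultimately show ?thesis
    by simp
qed

lemma presented_group_carrierE:
  assumes "A \<in> carrier (presented_group X R)"
  obtains w where "w \<in> gwords X" "A = presentation_rel X R `` {w}"
  using assms unfolding presented_group_def by (auto elim: quotientE)

lemma presented_group_class_closed [simp]:
  "w \<in> gwords X \<Longrightarrow> presentation_rel X R `` {w} \<in> carrier (presented_group X R)"
  unfolding presented_group_def by (auto intro: quotientI)

lemma presented_group_one: "\<one>\<^bsub>presented_group X R\<^esub> = presentation_rel X R `` {[]}"
  by (simp add: presented_group_def)

lemma group_presented_group: "group (presented_group X R)"
proof (rule groupI)
  fix A B C
  assume "A \<in> carrier (presented_group X R)" "B \<in> carrier (presented_group X R)"
    "C \<in> carrier (presented_group X R)"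
  then obtain u v w where *: "u \<in> gwords X" "A = presentation_rel X R `` {u}"
    "v \<in> gwords X" "B = presentation_rel X R `` {v}"
    "w \<in> gwords X" "C = presentation_rel X R `` {w}"
    by (meson presented_group_carrierE)
  show "A \<otimes>\<^bsub>presented_group X R\<^esub> B \<in> carrier (presented_group X R)"
    using * by (simp add: presented_group_mult)
  show "(A \<otimes>\<^bsub>presented_group X R\<^esub> B) \<otimes>\<^bsub>presented_group X R\<^esub> C =
      A \<otimes>\<^bsub>presented_group X R\<^esub> (B \<otimes>\<^bsub>presented_group X R\<^esub> C)"
    using * by (simp add: presented_group_mult)
next
  fix A
  assume "A \<in> carrier (presented_group X R)"
  then obtain w where w: "w \<in> gwords X" "A = presentation_rel X R `` {w}"
    by (rule presented_group_carrierE)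
  show "\<one>\<^bsub>presented_group X R\<^esub> \<otimes>\<^bsub>presented_group X R\<^esub> A = A"
    using w by (simp add: presented_group_one presented_group_mult)
  have "presentation_rel X R `` {word_inverse w} \<otimes>\<^bsub>presented_group X R\<^esub> A =
      \<one>\<^bsub>presented_group X R\<^esub>"
    using w presentation_rel_word_inverse[OF w(1), of R]
    by (simp add: presented_group_one presented_group_mult presentation_class_eq_iff)
  then show "\<exists>B\<in>carrier (presented_group X R).
      B \<otimes>\<^bsub>presented_group X R\<^esub> A = \<one>\<^bsub>presented_group X R\<^esub>"
    using w by (meson presented_group_class_closed word_inverse_gwords)
qed (simp add: presented_group_one)

lemma (in group) word_eval_presentation_rel:
  assumes e: "e \<in> X \<rightarrow> carrier G"
    and R: "\<And>r. r \<in> R \<Longrightarrow> r \<in> gwords X \<Longrightarrow> word_eval G e r = \<one>"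
    and "(u, v) \<in> presentation_rel X R"
  shows "word_eval G e u = word_eval G e v"
  using assms(3)
proof (induction rule: presentation_rel.induct)
  case (cancel u v x s)
  then have "e x \<in> carrier G"
    using e by auto
  then have "word_eval G e [(x, s), (x, \<not> s)] = \<one>"
    by simp
  moreover have "[(x, s), (x, \<not> s)] \<in> gwords X"
    using cancel by simp
  ultimately show ?case
    using cancel by (simp only: word_eval_append[OF e] gwords_simps word_eval_closed[OF e] l_one)
next
  case (relator u v r)
  then show ?case
    by (simp add: word_eval_append[OF e] R word_eval_closed[OF e])
qed auto

text \<open>Von Dyck's theorem. A class is evaluated at a representative picked by
  \<open>SOME\<close>; the value is independent of the choice because all relators are trivial in
  \<open>K\<close>.\<close>

lemma presented_group_hom:
  assumes "group K" "e \<in> X \<rightarrow> carrier K"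
    and "\<And>r. r \<in> R \<Longrightarrow> r \<in> gwords X \<Longrightarrow> word_eval K e r = \<one>\<^bsub>K\<^esub>"
  obtains \<Phi> where "\<Phi> \<in> hom (presented_group X R) K"
    "\<And>w. w \<in> gwords X \<Longrightarrow> \<Phi> (presentation_rel X R `` {w}) = word_eval K e w"
proof
  interpret K: group K by fact
  define \<Phi> where "\<Phi> A = word_eval K e (SOME w. w \<in> A)" for A
  show *: "\<Phi> (presentation_rel X R `` {w}) = word_eval K e w" if "w \<in> gwords X" for w
  proof -
    have "(SOME v. v \<in> presentation_rel X R `` {w}) \<in> presentation_rel X R `` {w}"
      using presentation_rel.refl[OF that, of R] by (intro someI) auto
    then show ?thesis
      using K.word_eval_presentation_rel[OF assms(2,3)] unfolding \<Phi>_def by (metis Image_singleton_iff)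
  qed
  show "\<Phi> \<in> hom (presented_group X R) K"
  proof (rule homI)
    fix A
    assume "A \<in> carrier (presented_group X R)"
    then show "\<Phi> A \<in> carrier K"
      using * K.word_eval_closed[OF assms(2)] by (auto elim: presented_group_carrierE)
  next
    fix A B
    assume "A \<in> carrier (presented_group X R)" "B \<in> carrier (presented_group X R)"
    then obtain u v where "u \<in> gwords X" "A = presentation_rel X R `` {u}"
      "v \<in> gwords X" "B = presentation_rel X R `` {v}"
      by (meson presented_group_carrierE)
    then show "\<Phi> (A \<otimes>\<^bsub>presented_group X R\<^esub> B) = \<Phi> A \<otimes>\<^bsub>K\<^esub> \<Phi> B"
      by (simp add: presented_group_mult * K.word_eval_append[OF assms(2)])
  qed
qed

section \<open>HNN extensions\<close>

text \<open>The universal property: the multiplication table holds as \<open>\<phi>\<close> is a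
  homomorphism, and the commutator relators hold by \<open>comm\<close>.\<close>

lemma HNN_hom:
  assumes "group A" "group K" "H \<subseteq> carrier A" and \<phi>: "\<phi> \<in> hom A K" and \<tau>: "\<tau> \<in> carrier K"
    and comm: "\<And>h. h \<in> H \<Longrightarrow> \<tau> \<otimes>\<^bsub>K\<^esub> \<phi> h = \<phi> h \<otimes>\<^bsub>K\<^esub> \<tau>"
  obtains \<Phi> where "\<Phi> \<in> hom (HNN A H) K"
    "\<And>a. a \<in> carrier A \<Longrightarrow> \<Phi> (HNN_generator A H (Base a)) = \<phi> a"
    "\<Phi> (HNN_generator A H Stable) = \<tau>"
proof -
  interpret A: group A by fact
  interpret K: group K by fact
  let ?e = "\<lambda>x. case x of Base a \<Rightarrow> \<phi> a | Stable \<Rightarrow> \<tau>"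
  have \<phi>_closed: "\<phi> a \<in> carrier K" if "a \<in> carrier A" for a
    using \<phi> that by (auto simp: hom_def)
  have e: "?e \<in> hnn_generators A \<rightarrow> carrier K"
    using \<phi>_closed \<tau> by (auto simp: hnn_generators_def)
  have rel: "word_eval K ?e r = \<one>\<^bsub>K\<^esub>" if "r \<in> hnn_relators A H" for r
    using that unfolding hnn_relators_def
  proof
    assume "r \<in> {[(Base a, True), (Base b, True), (Base (a \<otimes>\<^bsub>A\<^esub> b), False)] | a b.
        a \<in> carrier A \<and> b \<in> carrier A}"
    then obtain a b where r: "r = [(Base a, True), (Base b, True), (Base (a \<otimes>\<^bsub>A\<^esub> b), False)]"
      and ab: "a \<in> carrier A" "b \<in> carrier A"
      by blast
    have "\<phi> (a \<otimes>\<^bsub>A\<^esub> b) = \<phi> a \<otimes>\<^bsub>K\<^esub> \<phi> b"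
      using \<phi> ab by (simp add: hom_mult)
    then show ?thesis
      using ab \<phi>_closed by (simp add: r flip: K.m_assoc)
  next
    assume "r \<in> {[(Stable, False), (Base h, False), (Stable, True), (Base h, True)] | h. h \<in> H}"
    then obtain h where r: "r = [(Stable, False), (Base h, False), (Stable, True), (Base h, True)]"
      and h: "h \<in> H"
      by blast
    have "\<phi> h \<in> carrier K"
      using h assms(3) \<phi>_closed by blast
    then have "word_eval K ?e r = inv\<^bsub>K\<^esub> (\<phi> h \<otimes>\<^bsub>K\<^esub> \<tau>) \<otimes>\<^bsub>K\<^esub> (\<tau> \<otimes>\<^bsub>K\<^esub> \<phi> h)"
      using \<tau> by (simp add: r K.inv_mult_group K.m_assoc)
    then show ?thesis
      using \<open>\<phi> h \<in> carrier K\<close> \<tau> comm[OF h] by simp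
  qed
  obtain \<Phi> where \<Phi>: "\<Phi> \<in> hom (HNN A H) K" "\<And>w. w \<in> gwords (hnn_generators A) \<Longrightarrow>
      \<Phi> (presentation_rel (hnn_generators A) (hnn_relators A H) `` {w}) = word_eval K ?e w"
    unfolding HNN_def using presented_group_hom[OF assms(2) e rel] by metis
  show thesis
  proof
    show "\<Phi> (HNN_generator A H (Base a)) = \<phi> a" if "a \<in> carrier A" for a
      using that \<phi>_closed \<Phi>(2)[of "[(Base a, True)]"]
      by (simp add: HNN_generator_def) (simp add: hnn_generators_def)
    show "\<Phi> (HNN_generator A H Stable) = \<tau>"
      using \<tau> \<Phi>(2)[of "[(Stable, True)]"]
      by (simp add: HNN_generator_def) (simp add: hnn_generators_def)
  qed (rule \<Phi>(1))
qed

lemma group_HNN: "group (HNN A H)"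
  unfolding HNN_def by (rule group_presented_group)

lemma HNN_generator_closed: "x \<in> hnn_generators A \<Longrightarrow> HNN_generator A H x \<in> carrier (HNN A H)"
  unfolding HNN_def HNN_generator_def by simp

lemma HNN_generator_commute:
  assumes "H \<subseteq> carrier A" "h \<in> H"
  shows "HNN_generator A H Stable \<otimes>\<^bsub>HNN A H\<^esub> HNN_generator A H (Base h) =
    HNN_generator A H (Base h) \<otimes>\<^bsub>HNN A H\<^esub> HNN_generator A H Stable"
proof -
  let ?X = "hnn_generators A" and ?R = "hnn_relators A H"
  let ?t = "(Stable, True)" and ?t' = "(Stable, False)"
    and ?h = "(Base h, True)" and ?h' = "(Base h, False)"
  have X: "Stable \<in> ?X" "Base h \<in> ?X"
    using assms by (auto simp: hnn_generators_def)
  \<comment> \<open>This is \<open>h t\<close> followed by the commutator relator. Deleting the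
    relator leaves \<open>h t\<close>, while free cancellation in the middle leaves
    \<open>t h\<close>.\<close>
  let ?w = "[?h, ?t, ?t', ?h', ?t, ?h]"
  have 1: "(?w, [?h, ?t]) \<in> presentation_rel ?X ?R"
    using X assms(2) presentation_rel.relator[of "[?h, ?t]" ?X "[]" "[?t', ?h', ?t, ?h]" ?R]
    by (auto simp: hnn_relators_def)
  have 2: "(?w, [?h, ?h', ?t, ?h]) \<in> presentation_rel ?X ?R"
    using X presentation_rel.cancel[of "[?h]" ?X "[?h', ?t, ?h]" Stable True ?R] by simp
  have 3: "([?h, ?h', ?t, ?h], [?t, ?h]) \<in> presentation_rel ?X ?R"
    using X presentation_rel.cancel[of "[]" ?X "[?t, ?h]" "Base h" True ?R] by simp
  have "([?t, ?h], [?h, ?t]) \<in> presentation_rel ?X ?R"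
    using presentation_rel.trans[OF presentation_rel.sym[OF presentation_rel.trans[OF 2 3]] 1] .
  then show ?thesis
    using X by (simp add: HNN_def HNN_generator_def presented_group_mult presentation_class_eq_iff)
qed

text \<open>The universal property transferred to \<open>G\<close> by composing with the inverse of
  the isomorphism from \<open>HNN A H\<close>.\<close>

lemma is_HNN_extension_hom:
  assumes "group A" "group G" "group K" "H \<subseteq> carrier A" and G: "is_HNN_extension G A i H t"
    and "\<phi> \<in> hom A K" "\<tau> \<in> carrier K"
    and "\<And>h. h \<in> H \<Longrightarrow> \<tau> \<otimes>\<^bsub>K\<^esub> \<phi> h = \<phi> h \<otimes>\<^bsub>K\<^esub> \<tau>"
  obtains \<Phi> where "\<Phi> \<in> hom G K" "\<And>a. a \<in> carrier A \<Longrightarrow> \<Phi> (i a) = \<phi> a" "\<Phi> t = \<tau>"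
proof -
  obtain \<Phi> where \<Phi>: "\<Phi> \<in> hom (HNN A H) K"
    "\<And>a. a \<in> carrier A \<Longrightarrow> \<Phi> (HNN_generator A H (Base a)) = \<phi> a"
    "\<Phi> (HNN_generator A H Stable) = \<tau>"
    using HNN_hom[OF assms(1,3,4,6-8)] by blast
  obtain \<psi> where \<psi>: "\<psi> \<in> iso (HNN A H) G"
    "\<And>a. a \<in> carrier A \<Longrightarrow> \<psi> (HNN_generator A H (Base a)) = i a"
    "\<psi> (HNN_generator A H Stable) = t"
    using G unfolding is_HNN_extension_def by blast
  let ?\<psi>' = "inv_into (carrier (HNN A H)) \<psi>"
  have "?\<psi>' \<in> iso G (HNN A H)"
    using group.iso_set_sym[OF group_HNN \<psi>(1)] .
  then have hom: "\<Phi> \<circ> ?\<psi>' \<in> hom G K"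
    using \<Phi>(1) hom_compose iso_imp_homomorphism by blast
  have inj: "inj_on \<psi> (carrier (HNN A H))"
    using \<psi>(1) by (auto simp: iso_def bij_betw_def)
  have "?\<psi>' (i a) = HNN_generator A H (Base a)" if "a \<in> carrier A" for a
    using inv_into_f_f[OF inj HNN_generator_closed, of "Base a"] \<psi>(2) that
    by (simp add: hnn_generators_def)
  moreover have "?\<psi>' t = HNN_generator A H Stable"
    using inv_into_f_f[OF inj HNN_generator_closed, of Stable] \<psi>(3)
    by (simp add: hnn_generators_def)
  ultimately show thesis
    using that[OF hom] \<Phi> by simp
qed

lemma is_HNN_extension_commute:
  assumes "is_HNN_extension G A i H t" "H \<subseteq> carrier A" "h \<in> H"
  shows "t \<otimes>\<^bsub>G\<^esub> i h = i h \<otimes>\<^bsub>G\<^esub> t"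
proof -
  obtain \<psi> where \<psi>: "\<psi> \<in> iso (HNN A H) G"
    "\<And>a. a \<in> carrier A \<Longrightarrow> \<psi> (HNN_generator A H (Base a)) = i a"
    "\<psi> (HNN_generator A H Stable) = t"
    using assms(1) unfolding is_HNN_extension_def by blast
  have "HNN_generator A H Stable \<in> carrier (HNN A H)" "HNN_generator A H (Base h) \<in> carrier (HNN A H)"
    using assms by (auto intro!: HNN_generator_closed simp: hnn_generators_def)
  moreover have "h \<in> carrier A"
    using assms by blast
  ultimately show ?thesis
    using arg_cong[OF HNN_generator_commute[OF assms(2,3)], of \<psi>]
    by (simp add: hom_mult[OF iso_imp_homomorphism[OF \<psi>(1)]] \<psi>)
qed

text \<open>
  By Britton's lemma a commutator of \<open>t\<close> and \<open>f t f\<^sup>-\<^sup>1\<close> is trivial only for \<open>f \<in> H\<close>. Instead of proving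
  normal forms, we detect this in a single quotient: two copies of the base group, acted upon
  diagonally, and three points \<open>0, 1, 2\<close>, which the stable letter permutes by \<open>(0 1)\<close> over the
  first copy of \<open>H\<close> and by \<open>(1 2)\<close> over the second one.
\<close>

definition hnn_base_action :: "('a, 'b) monoid_scheme \<Rightarrow> 'a \<Rightarrow> 'a \<times> 'a \<times> nat \<Rightarrow> 'a \<times> 'a \<times> nat" where
  "hnn_base_action A a = (\<lambda>(u, v, s).
     if u \<in> carrier A \<and> v \<in> carrier A then (a \<otimes>\<^bsub>A\<^esub> u, a \<otimes>\<^bsub>A\<^esub> v, s) else (u, v, s))"

definition hnn_stable_action :: "'a set \<Rightarrow> 'a \<times> 'a \<times> nat \<Rightarrow> 'a \<times> 'a \<times> nat" where
  "hnn_stable_action H = (\<lambda>(u, v, s).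
     (u, v, if u \<in> H then Transposition.transpose 0 1 s
            else if v \<in> H then Transposition.transpose 1 2 s else s))"

lemma carrier_BijGroup_UNIV: "carrier (BijGroup UNIV) = {f. bij f}"
  by (simp add: BijGroup_def Bij_def)

lemma mult_BijGroup_UNIV: "bij f \<Longrightarrow> bij g \<Longrightarrow> f \<otimes>\<^bsub>BijGroup UNIV\<^esub> g = f \<circ> g"
  by (auto simp: BijGroup_def Bij_def compose_def)

lemma one_BijGroup_UNIV: "\<one>\<^bsub>BijGroup UNIV\<^esub> = id"
  by (auto simp: BijGroup_def)

lemma hnn_stable_action_involution: "hnn_stable_action H \<circ> hnn_stable_action H = id"
  by (auto simp: hnn_stable_action_def fun_eq_iff)

lemma bij_hnn_stable_action: "bij (hnn_stable_action H)"
  using hnn_stable_action_involution o_bij by blast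

lemma (in group) hnn_base_action_comp:
  assumes "a \<in> carrier G" "b \<in> carrier G"
  shows "hnn_base_action G a \<circ> hnn_base_action G b = hnn_base_action G (a \<otimes> b)"
  using assms by (auto simp: hnn_base_action_def fun_eq_iff m_assoc)

text \<open>Triples outside the carrier are left fixed, so the action of \<open>inv a\<close> is an
  inverse on the whole type.\<close>

lemma (in group) bij_hnn_base_action:
  assumes "a \<in> carrier G"
  shows "bij (hnn_base_action G a)"
proof -
  have "hnn_base_action G \<one> = id"
    by (auto simp: hnn_base_action_def fun_eq_iff)
  then show ?thesis
    using assms hnn_base_action_comp[of a "inv a"] hnn_base_action_comp[of "inv a" a]
    by (intro o_bij[of "hnn_base_action G (inv a)"]) simp_all
qed

lemma (in group) hnn_base_action_hom: "hnn_base_action G \<in> hom G (BijGroup UNIV)"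
  by (auto simp: hom_def carrier_BijGroup_UNIV mult_BijGroup_UNIV bij_hnn_base_action
      hnn_base_action_comp)

text \<open>Left multiplication by \<open>h\<close> does not change whether a coordinate lies in
  \<open>H\<close>, so the same permutation of the third coordinate is chosen before and after
  it.\<close>

lemma (in group) hnn_actions_commute:
  assumes "subgroup H G" "h \<in> H"
  shows "hnn_stable_action H \<circ> hnn_base_action G h = hnn_base_action G h \<circ> hnn_stable_action H"
proof -
  interpret H: subgroup H G by fact
  have "h \<otimes> u \<in> H \<longleftrightarrow> u \<in> H" if "u \<in> carrier G" for u
  proof -
    have "inv h \<otimes> (h \<otimes> u) = u"
      using that H.mem_carrier[OF assms(2)] by (subst m_assoc[symmetric]) simp_all
    then show ?thesis
      using H.m_closed[OF assms(2)] H.m_closed[OF H.m_inv_closed[OF assms(2)]] by metis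
  qed
  then show ?thesis
    unfolding fun_eq_iff hnn_stable_action_def hnn_base_action_def
    by (auto simp: split_beta)
qed

section \<open>Consequences of the permutation quotient\<close>

lemma is_HNN_extension_quotient:
  assumes "group A" "group G" "subgroup H A" "is_HNN_extension G A i H t"
  obtains \<Phi> where "\<Phi> \<in> hom G (BijGroup UNIV)"
    "\<And>a. a \<in> carrier A \<Longrightarrow> \<Phi> (i a) = hnn_base_action A a" "\<Phi> t = hnn_stable_action H"
proof -
  interpret A: group A by fact
  have H: "H \<subseteq> carrier A"
    using assms(3) by (rule subgroup.subset)
  show thesis
  proof (rule is_HNN_extension_hom[OF assms(1,2) group_BijGroup H assms(4) A.hnn_base_action_hom])
    show "hnn_stable_action H \<in> carrier (BijGroup UNIV)"
      by (simp add: carrier_BijGroup_UNIV bij_hnn_stable_action)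
    show "hnn_stable_action H \<otimes>\<^bsub>BijGroup UNIV\<^esub> hnn_base_action A h =
        hnn_base_action A h \<otimes>\<^bsub>BijGroup UNIV\<^esub> hnn_stable_action H" if "h \<in> H" for h
      using A.hnn_actions_commute[OF assms(3) that] H that
      by (auto simp: mult_BijGroup_UNIV bij_hnn_stable_action A.bij_hnn_base_action)
  qed (rule that)
qed

lemma is_HNN_extension_stable_ne_one:
  assumes "group A" "group G" "subgroup H A" "is_HNN_extension G A i H t"
  shows "t \<noteq> \<one>\<^bsub>G\<^esub>"
proof
  assume "t = \<one>\<^bsub>G\<^esub>"
  moreover obtain \<Phi> where "\<Phi> \<in> hom G (BijGroup UNIV)" "\<Phi> t = hnn_stable_action H"
    using is_HNN_extension_quotient[OF assms] by metis
  ultimately have "hnn_stable_action H = id"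
    using hom_one[OF _ assms(2) group_BijGroup] by (metis one_BijGroup_UNIV)
  moreover have "hnn_stable_action H (\<one>\<^bsub>A\<^esub>, \<one>\<^bsub>A\<^esub>, 0) = (\<one>\<^bsub>A\<^esub>, \<one>\<^bsub>A\<^esub>, 1)"
    using subgroup.one_closed[OF assms(3)] by (simp add: hnn_stable_action_def)
  ultimately show False
    by simp
qed

context
  fixes A :: "('a, 'b) monoid_scheme" and G :: "('c, 'd) monoid_scheme" and i H t f
  assumes groups: "group A" "group G" "subgroup H A"
    and hnn: "is_HNN_extension G A i H t"
    and f: "f \<in> carrier A"
begin

interpretation A: group A by (rule groups)
interpretation G: group G by (rule groups)
interpretation K: group "BijGroup UNIV" by (rule group_BijGroup)

lemma is_HNN_extension_closed: "t \<in> carrier G" "i f \<in> carrier G"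
proof -
  show "i f \<in> carrier G"
    using hnn f by (auto simp: is_HNN_extension_def hom_def)
  obtain \<psi> where "\<psi> \<in> iso (HNN A H) G" "\<psi> (HNN_generator A H Stable) = t"
    using hnn unfolding is_HNN_extension_def by blast
  then show "t \<in> carrier G"
    using HNN_generator_closed[of Stable A H] hom_in_carrier[OF iso_imp_homomorphism]
    by (fastforce simp: hnn_generators_def)
qed

lemma is_HNN_extension_conj_commute_stable:
  assumes "(i f \<otimes>\<^bsub>G\<^esub> t \<otimes>\<^bsub>G\<^esub> inv\<^bsub>G\<^esub> (i f)) \<otimes>\<^bsub>G\<^esub> t =
    t \<otimes>\<^bsub>G\<^esub> (i f \<otimes>\<^bsub>G\<^esub> t \<otimes>\<^bsub>G\<^esub> inv\<^bsub>G\<^esub> (i f))"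
  shows "f \<in> H"
proof (rule ccontr)
  assume nf: "f \<notin> H"
  interpret H: subgroup H A by (rule groups)
  have nf': "inv\<^bsub>A\<^esub> f \<notin> H"
    using nf f H.m_inv_closed[of "inv\<^bsub>A\<^esub> f"] by auto
  obtain \<Phi> where \<Phi>: "\<Phi> \<in> hom G (BijGroup UNIV)"
    "\<And>a. a \<in> carrier A \<Longrightarrow> \<Phi> (i a) = hnn_base_action A a" "\<Phi> t = hnn_stable_action H"
    using is_HNN_extension_quotient[OF groups hnn] by metis
  interpret \<Phi>: group_hom G "BijGroup UNIV" \<Phi>
    by unfold_locales (rule \<Phi>(1))
  let ?l = "hnn_base_action A" and ?t = "hnn_stable_action H"
  interpret l: group_hom A "BijGroup UNIV" ?l
    by unfold_locales (rule A.hnn_base_action_hom)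
  note bij = bij_hnn_stable_action A.bij_hnn_base_action bij_comp
  have "?l f \<circ> ?t \<circ> ?l (inv\<^bsub>A\<^esub> f) \<circ> ?t = ?t \<circ> (?l f \<circ> ?t \<circ> ?l (inv\<^bsub>A\<^esub> f))"
    using arg_cong[OF assms, of \<Phi>] is_HNN_extension_closed f
    by (simp add: \<Phi> mult_BijGroup_UNIV bij flip: l.hom_inv)
  \<comment> \<open>Over the pair \<open>(\<one>, f)\<close> the stable letter acts by
    \<open>(0 1)\<close> and its conjugate by \<open>(1 2)\<close>, as conjugation shifts the pair
    to \<open>(inv f, \<one>)\<close>. These transpositions do not commute: starting from 2, the
    left side ends at 1 and the right side at 0.\<close>
  from fun_cong[OF this, of "(\<one>\<^bsub>A\<^esub>, f, 2)"] show False
    using f nf nf' H.one_closed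
    by (simp add: hnn_stable_action_def hnn_base_action_def Transposition.transpose_def)
qed

lemma is_HNN_extension_conj_commute_base:
  assumes "(t \<otimes>\<^bsub>G\<^esub> i f \<otimes>\<^bsub>G\<^esub> inv\<^bsub>G\<^esub> t) \<otimes>\<^bsub>G\<^esub> i f = i f \<otimes>\<^bsub>G\<^esub> (t \<otimes>\<^bsub>G\<^esub> i f \<otimes>\<^bsub>G\<^esub> inv\<^bsub>G\<^esub> t)"
  shows "f \<in> H"
proof (rule ccontr)
  assume nf: "f \<notin> H"
  interpret H: subgroup H A by (rule groups)
  have nf': "inv\<^bsub>A\<^esub> f \<notin> H"
    using nf f H.m_inv_closed[of "inv\<^bsub>A\<^esub> f"] by auto
  obtain \<Phi> where \<Phi>: "\<Phi> \<in> hom G (BijGroup UNIV)"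
    "\<And>a. a \<in> carrier A \<Longrightarrow> \<Phi> (i a) = hnn_base_action A a" "\<Phi> t = hnn_stable_action H"
    using is_HNN_extension_quotient[OF groups hnn] by metis
  interpret \<Phi>: group_hom G "BijGroup UNIV" \<Phi>
    by unfold_locales (rule \<Phi>(1))
  let ?l = "hnn_base_action A" and ?t = "hnn_stable_action H"
  note bij = bij_hnn_stable_action A.bij_hnn_base_action bij_comp
  have "inv\<^bsub>BijGroup UNIV\<^esub> ?t = ?t"
    by (rule K.inv_equality)
      (simp_all add: mult_BijGroup_UNIV one_BijGroup_UNIV carrier_BijGroup_UNIV bij
        hnn_stable_action_involution)
  then have "?t \<circ> ?l f \<circ> ?t \<circ> ?l f = ?l f \<circ> (?t \<circ> ?l f \<circ> ?t)"
    using arg_cong[OF assms, of \<Phi>] is_HNN_extension_closed f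
    by (simp add: \<Phi> mult_BijGroup_UNIV bij)
  \<comment> \<open>On the right the third coordinate runs from 2 to 1 over
    \<open>(inv f, \<one>)\<close> and then to 0 over \<open>(\<one>, f)\<close>. On the left the
    first stable letter acts over \<open>(\<one>, f)\<close> and fixes 2; the last acts over a pair
    with first entry \<open>f\<close> outside \<open>H\<close>, so that 0 is never reached.\<close>
  from fun_cong[OF this, of "(inv\<^bsub>A\<^esub> f, \<one>\<^bsub>A\<^esub>, 2)"] show False
    using f nf nf' H.one_closed
    by (auto simp: hnn_stable_action_def hnn_base_action_def Transposition.transpose_def
        split: if_splits)
qed

end

section \<open>Limits of marked groups\<close>

lemma relations_upto_restrict:
  "R \<le> R' \<Longrightarrow> relations_upto M R = {w \<in> relations_upto M R'. length w \<le> R}"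
  by (auto simp: relations_upto_def)

text \<open>An infimum below \<open>exp (- R)\<close> provides some \<open>R' > R\<close> up to
  which the relations agree, and agreement up to \<open>R'\<close> restricts to
  \<open>R\<close>.\<close>

lemma marked_converges_relations_upto:
  assumes "marked_converges M N"
  shows "\<forall>\<^sub>F n in sequentially. relations_upto (M n) R = relations_upto N R"
proof -
  have "\<forall>\<^sub>F n in sequentially. marked_dist (M n) N < exp (- real R)"
    using assms unfolding marked_converges_def by (rule order_tendstoD) simp
  then show ?thesis
  proof (rule eventually_mono)
    fix n
    let ?E = "{exp (- real R) | R. relations_upto (M n) R = relations_upto N R}"
    assume "marked_dist (M n) N < exp (- real R)"
    moreover have "relations_upto (M n) 0 = relations_upto N 0"
      by (cases "M n"; cases N) (auto simp: relations_upto_def)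
    then have "?E \<noteq> {}"
      by blast
    ultimately obtain R' where R': "relations_upto (M n) R' = relations_upto N R'"
      and "exp (- real R') < exp (- real R)"
      unfolding marked_dist_def using cInf_lessD[of ?E] by blast
    then have "R \<le> R'"
      by simp
    then show "relations_upto (M n) R = relations_upto N R"
      using R' relations_upto_restrict[of R R' "M n"] relations_upto_restrict[of R R' N] by simp
  qed
qed

locale marked_limit =
  fixes A :: "nat \<Rightarrow> ('a, 'b) monoid_scheme" and S :: "nat \<Rightarrow> 'a list"
    and G :: "('c, 'd) monoid_scheme" and T :: "'c list"
  assumes group_A: "group (A n)" and group_G: "group G"
    and S: "set (S n) \<subseteq> carrier (A n)" "length (S n) = length T" and T: "set T \<subseteq> carrier G"
    and converges: "marked_converges (\<lambda>n. (A n, S n)) (G, T)"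
begin

text \<open>An element of the limit and a sequence are linked by one word that represents both. Its
  length does not depend on \<open>n\<close>, so equations between such elements can be compared
  through relations of bounded length.\<close>

definition limit_of :: "'c \<Rightarrow> (nat \<Rightarrow> 'a) \<Rightarrow> bool" where
  "limit_of y x \<longleftrightarrow> (\<exists>w \<in> gwords {..<length T}.
     (\<forall>n. word_value (A n, S n) w = x n) \<and> word_value (G, T) w = y)"

lemma generators_closed: "(!) (S n) \<in> {..<length T} \<rightarrow> carrier (A n)" "(!) T \<in> {..<length T} \<rightarrow> carrier G"
  using S T by (auto simp: subset_iff in_set_conv_nth)

lemma limit_of_closed:
  assumes "limit_of y x"
  shows "y \<in> carrier G" "x n \<in> carrier (A n)"
proof -
  obtain w where w: "w \<in> gwords {..<length T}" "\<And>n. word_value (A n, S n) w = x n"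
    "word_value (G, T) w = y"
    using assms unfolding limit_of_def by blast
  show "y \<in> carrier G" "x n \<in> carrier (A n)"
    using group.word_eval_closed[OF group_G generators_closed(2) w(1)]
      group.word_eval_closed[OF group_A generators_closed(1) w(1), of n]
    by (simp_all add: w flip: word_value_eq_word_eval)
qed

lemma limit_of_one: "limit_of \<one>\<^bsub>G\<^esub> (\<lambda>n. \<one>\<^bsub>A n\<^esub>)"
  unfolding limit_of_def by (rule bexI[of _ "[]"]) auto

lemma limit_of_generator:
  assumes "j < length T"
  shows "limit_of (T ! j) (\<lambda>n. S n ! j)"
proof -
  have "T ! j \<in> carrier G" "S n ! j \<in> carrier (A n)" for n
    using assms generators_closed by (auto simp: Pi_iff)
  then show ?thesis
    unfolding limit_of_def using assms monoid.r_one[OF group.is_monoid[OF group_A]]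
      monoid.r_one[OF group.is_monoid[OF group_G]]
    by (intro bexI[of _ "[(j, True)]"]) auto
qed

lemma limit_of_mult:
  assumes "limit_of y x" "limit_of y' x'"
  shows "limit_of (y \<otimes>\<^bsub>G\<^esub> y') (\<lambda>n. x n \<otimes>\<^bsub>A n\<^esub> x' n)"
proof -
  obtain w w' where "w \<in> gwords {..<length T}" "\<And>n. word_value (A n, S n) w = x n"
    "word_value (G, T) w = y" "w' \<in> gwords {..<length T}" "\<And>n. word_value (A n, S n) w' = x' n"
    "word_value (G, T) w' = y'"
    using assms unfolding limit_of_def by blast
  then show ?thesis
    unfolding limit_of_def
    by (intro bexI[of _ "w @ w'"])
      (auto simp: word_value_eq_word_eval group.word_eval_append[OF group_A generators_closed(1)]
        group.word_eval_append[OF group_G generators_closed(2)])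
qed

lemma limit_of_inv:
  assumes "limit_of y x"
  shows "limit_of (inv\<^bsub>G\<^esub> y) (\<lambda>n. inv\<^bsub>A n\<^esub> x n)"
proof -
  obtain w where "w \<in> gwords {..<length T}" "\<And>n. word_value (A n, S n) w = x n"
    "word_value (G, T) w = y"
    using assms unfolding limit_of_def by blast
  then show ?thesis
    unfolding limit_of_def
    by (intro bexI[of _ "word_inverse w"])
      (auto simp: word_value_eq_word_eval group.word_eval_word_inverse[OF group_A generators_closed(1)]
        group.word_eval_word_inverse[OF group_G generators_closed(2)])
qed

lemma limit_of_eq_one_iff:
  assumes "limit_of y x"
  shows "y = \<one>\<^bsub>G\<^esub> \<longleftrightarrow> (\<forall>\<^sub>F n in sequentially. x n = \<one>\<^bsub>A n\<^esub>)"
proof -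
  obtain w where w: "w \<in> gwords {..<length T}" "\<And>n. word_value (A n, S n) w = x n"
    "word_value (G, T) w = y"
    using assms unfolding limit_of_def by blast
  have "\<forall>\<^sub>F n in sequentially. (x n = \<one>\<^bsub>A n\<^esub>) = (y = \<one>\<^bsub>G\<^esub>)"
    using marked_converges_relations_upto[OF converges, of "length w"]
  proof (rule eventually_mono)
    fix n
    assume "relations_upto (A n, S n) (length w) = relations_upto (G, T) (length w)"
    then have "w \<in> relations_upto (A n, S n) (length w) \<longleftrightarrow> w \<in> relations_upto (G, T) (length w)"
      by simp
    then show "(x n = \<one>\<^bsub>A n\<^esub>) = (y = \<one>\<^bsub>G\<^esub>)"
      using w S(2) by (simp add: relations_upto_def)
  qed
  from eventually_subst[OF this] show ?thesis
    by simp
qed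

lemma limit_of_eq_iff:
  assumes "limit_of y x" "limit_of y' x'"
  shows "y = y' \<longleftrightarrow> (\<forall>\<^sub>F n in sequentially. x n = x' n)"
proof -
  have *: "u \<otimes>\<^bsub>K\<^esub> inv\<^bsub>K\<^esub> v = \<one>\<^bsub>K\<^esub> \<longleftrightarrow> u = v"
    if "group K" "u \<in> carrier K" "v \<in> carrier K" for K :: "('k, 'l) monoid_scheme" and u v
    using group.inv_solve_right'[OF that(1), of "\<one>\<^bsub>K\<^esub>" u v] that
      monoid.l_one[OF group.is_monoid[OF that(1)]] by (metis group.is_monoid monoid.one_closed)
  show ?thesis
    using limit_of_eq_one_iff[OF limit_of_mult[OF assms(1) limit_of_inv[OF assms(2)]]]
      *[OF group_G limit_of_closed(1)[OF assms(1)] limit_of_closed(1)[OF assms(2)]]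
      *[OF group_A limit_of_closed(2)[OF assms(1)] limit_of_closed(2)[OF assms(2)]]
    by simp
qed

end

text \<open>
  That \<open>x\<^sub>0, x\<^sub>1\<close> generate Thompson's group need not be proved separately: sending the stable letter
  to 1 retracts \<open>G\<close> onto the base group, and the given generators of \<open>G\<close> onto \<open>1, x\<^sub>0, x\<^sub>1\<close>.
\<close>

lemma is_HNN_extension_generate_base:
  assumes "group A" "group G" "subgroup H A" "is_HNN_extension G A i H t"
    and "X \<subseteq> carrier A" "generate G (insert t (i ` X)) = carrier G"
  shows "generate A (insert \<one>\<^bsub>A\<^esub> X) = carrier A"
proof -
  interpret A: group A by fact
  have H: "H \<subseteq> carrier A"
    using assms(3) by (rule subgroup.subset)
  obtain \<rho> where \<rho>: "\<rho> \<in> hom G A" "\<And>a. a \<in> carrier A \<Longrightarrow> \<rho> (i a) = a" "\<rho> t = \<one>\<^bsub>A\<^esub>"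
  proof (rule is_HNN_extension_hom[OF assms(1,2,1) H assms(4)])
    show "(\<lambda>a. a) \<in> hom A A"
      by (simp add: hom_def)
    show "\<one>\<^bsub>A\<^esub> \<otimes>\<^bsub>A\<^esub> h = h \<otimes>\<^bsub>A\<^esub> \<one>\<^bsub>A\<^esub>" if "h \<in> H" for h
      using that H by auto
  qed simp_all
  interpret \<rho>: group_hom G A \<rho>
    using assms(1,2) \<rho>(1) by (simp add: group_hom_def group_hom_axioms_def)
  have i: "i a \<in> carrier G" if "a \<in> carrier A" for a
    using assms(4) that by (auto simp: is_HNN_extension_def hom_def)
  have t: "t \<in> carrier G"
    using is_HNN_extension_closed(1)[OF assms(1-4) A.one_closed] .
  have "\<rho> ` i ` X = (\<lambda>a. a) ` X"
    unfolding image_image using \<rho>(2) assms(5) by (intro image_cong) auto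
  then have "\<rho> ` insert t (i ` X) = insert \<one>\<^bsub>A\<^esub> X"
    using \<rho>(3) by simp
  then have "generate A (insert \<one>\<^bsub>A\<^esub> X) = \<rho> ` carrier G"
    using \<rho>.generate_img[of "insert t (i ` X)"] subsetD[OF assms(5)] assms(6) i t
    by (metis image_subset_iff insert_subset)
  also have "\<dots> = carrier A"
  proof
    show "carrier A \<subseteq> \<rho> ` carrier G"
      using \<rho>(2) i by (metis image_eqI subsetI)
  qed auto
  finally show ?thesis .
qed

theorem theorem4p8:
  fixes g\<^sub>n :: "nat \<Rightarrow> real \<Rightarrow> real"
    and G :: "('a, 'b) monoid_scheme"
    and g y\<^sub>0 y\<^sub>1 :: 'a
  assumes "\<And>n. g\<^sub>n n \<in> carrier ThompsonF"
    and "marked_group (G, [g, y\<^sub>0, y\<^sub>1])"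
    and "marked_converges (\<lambda>n. (ThompsonF, [g\<^sub>n n, x0, x1])) (G, [g, y\<^sub>0, y\<^sub>1])"
  shows "\<not> (\<exists>H i. subgroup H ThompsonF \<and>
             (\<exists>h'\<in>H. \<exists>h''\<in>H. {0, 1} \<subseteq> closure (supp h') \<union> closure (supp h'')) \<and>
             i x0 = y\<^sub>0 \<and> i x1 = y\<^sub>1 \<and>
             is_HNN_extension G ThompsonF i H g)"
proof
  assume "\<exists>H i. subgroup H ThompsonF \<and>
             (\<exists>h'\<in>H. \<exists>h''\<in>H. {0, 1} \<subseteq> closure (supp h') \<union> closure (supp h'')) \<and>
             i x0 = y\<^sub>0 \<and> i x1 = y\<^sub>1 \<and>
             is_HNN_extension G ThompsonF i H g"
  then obtain H i h' h'' where H: "subgroup H ThompsonF"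
    and h': "h' \<in> H" "h'' \<in> H" "{0, 1} \<subseteq> closure (supp h') \<union> closure (supp h'')"
    and i: "i x0 = y\<^sub>0" "i x1 = y\<^sub>1" and hnn: "is_HNN_extension G ThompsonF i H g"
    by blast
  have group_G: "group G" and gens: "g \<in> carrier G" "y\<^sub>0 \<in> carrier G" "y\<^sub>1 \<in> carrier G"
    and generate_G: "generate G {g, y\<^sub>0, y\<^sub>1} = carrier G"
    using assms(2) by (auto simp: marked_group_def)
  have g\<^sub>n: "g\<^sub>n n \<in> thompson_elements" for n
    using assms(1) by simp
  interpret F: group ThompsonF by (rule group_ThompsonF)
  interpret G: group G by (rule group_G)
  interpret marked_limit "\<lambda>_. ThompsonF" "\<lambda>n. [g\<^sub>n n, x0, x1]" G "[g, y\<^sub>0, y\<^sub>1]"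
    using assms(3) g\<^sub>n gens by unfold_locales (simp_all add: x0_closed x1_closed)
  have H_sub: "H \<subseteq> thompson_elements"
    using subgroup.subset[OF H] by simp
  have i_hom: "i \<in> hom ThompsonF G"
    using hnn by (simp add: is_HNN_extension_def)
  interpret i: group_hom ThompsonF G i
    by unfold_locales (rule i_hom)
  note comm_base = is_HNN_extension_conj_commute_base[OF group_ThompsonF group_G H hnn]
    and comm_stable = is_HNN_extension_conj_commute_stable[OF group_ThompsonF group_G H hnn]

  \<comment> \<open>Elements of the base group as limits of constant sequences\<close>
  have lim_g: "limit_of g g\<^sub>n"
    using limit_of_generator[of 0] by simp
  have lim_i: "limit_of (i f) (\<lambda>_. f)" if "f \<in> thompson_elements" for f
  proof -
    have "generate ThompsonF (insert \<one>\<^bsub>ThompsonF\<^esub> {x0, x1}) = carrier ThompsonF"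
      using generate_G by (intro is_HNN_extension_generate_base[OF group_ThompsonF group_G H hnn])
        (simp_all add: i x0_closed x1_closed)
    with that have "f \<in> generate ThompsonF {\<one>\<^bsub>ThompsonF\<^esub>, x0, x1}"
      by simp
    moreover have gen: "limit_of (i x) (\<lambda>_. x)" if "x \<in> {\<one>\<^bsub>ThompsonF\<^esub>, x0, x1}" for x
      using that limit_of_one limit_of_generator[of 1] limit_of_generator[of 2] by (auto simp: i)
    moreover have "{\<one>\<^bsub>ThompsonF\<^esub>, x0, x1} \<subseteq> carrier ThompsonF"
      using F.one_closed by (simp add: x0_closed x1_closed)
    note gen_closed = subsetD[OF this] F.generate_in_carrier[OF this]
    ultimately show ?thesis
    proof (induction rule: generate.induct)
      case one
      then show ?case
        using limit_of_one by simp
    next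
      case (incl h)
      then show ?case by simp
    next
      case (inv h)
      then show ?case
        using limit_of_inv[OF gen, of h] gen_closed(1)[of h] by simp
    next
      case (eng h1 h2)
      then show ?case
        using limit_of_mult[of "i h1" "\<lambda>_. h1" "i h2" "\<lambda>_. h2"] gen_closed(2) by simp
    qed
  qed
  note limits = limit_of_mult limit_of_inv lim_g lim_i

  \<comment> \<open>Passing between membership in \<open>H\<close> and eventual commutation\<close>
  have H_commute: "\<forall>\<^sub>F n in sequentially. g\<^sub>n n \<otimes>\<^bsub>ThompsonF\<^esub> h = h \<otimes>\<^bsub>ThompsonF\<^esub> g\<^sub>n n" if "h \<in> H" for h
  proof -
    have h: "h \<in> thompson_elements"
      using that H_sub by blast
    show ?thesis
      using is_HNN_extension_commute[OF hnn _ that] H_sub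
      by (subst limit_of_eq_iff[symmetric, OF limit_of_mult[OF lim_g lim_i[OF h]]
            limit_of_mult[OF lim_i[OF h] lim_g]]) simp
  qed
  \<comment> \<open>Commutation for almost all \<open>n\<close> is an equation in the limit
    \<open>G\<close>, to which the criterion for the HNN extension applies.\<close>
  have in_H1: "f \<in> H" if f: "f \<in> thompson_elements" and
    comm: "\<forall>\<^sub>F n in sequentially.
      (g\<^sub>n n \<otimes>\<^bsub>ThompsonF\<^esub> f \<otimes>\<^bsub>ThompsonF\<^esub> inv\<^bsub>ThompsonF\<^esub> g\<^sub>n n) \<otimes>\<^bsub>ThompsonF\<^esub> f =
      f \<otimes>\<^bsub>ThompsonF\<^esub> (g\<^sub>n n \<otimes>\<^bsub>ThompsonF\<^esub> f \<otimes>\<^bsub>ThompsonF\<^esub> inv\<^bsub>ThompsonF\<^esub> g\<^sub>n n)" for f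
  proof (rule comm_base)
    have c: "limit_of (g \<otimes>\<^bsub>G\<^esub> i f \<otimes>\<^bsub>G\<^esub> inv\<^bsub>G\<^esub> g)
        (\<lambda>n. g\<^sub>n n \<otimes>\<^bsub>ThompsonF\<^esub> f \<otimes>\<^bsub>ThompsonF\<^esub> inv\<^bsub>ThompsonF\<^esub> g\<^sub>n n)"
      by (intro limits f)
    show "g \<otimes>\<^bsub>G\<^esub> i f \<otimes>\<^bsub>G\<^esub> inv\<^bsub>G\<^esub> g \<otimes>\<^bsub>G\<^esub> i f = i f \<otimes>\<^bsub>G\<^esub> (g \<otimes>\<^bsub>G\<^esub> i f \<otimes>\<^bsub>G\<^esub> inv\<^bsub>G\<^esub> g)"
      using comm limit_of_eq_iff[OF limit_of_mult[OF c lim_i[OF f]] limit_of_mult[OF lim_i[OF f] c]]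
      by simp
  qed (use f in simp)
  have in_H2: "f \<in> H" if f: "f \<in> thompson_elements" and
    comm: "\<forall>\<^sub>F n in sequentially.
      (f \<otimes>\<^bsub>ThompsonF\<^esub> g\<^sub>n n \<otimes>\<^bsub>ThompsonF\<^esub> inv\<^bsub>ThompsonF\<^esub> f) \<otimes>\<^bsub>ThompsonF\<^esub> g\<^sub>n n =
      g\<^sub>n n \<otimes>\<^bsub>ThompsonF\<^esub> (f \<otimes>\<^bsub>ThompsonF\<^esub> g\<^sub>n n \<otimes>\<^bsub>ThompsonF\<^esub> inv\<^bsub>ThompsonF\<^esub> f)" for f
  proof (rule comm_stable)
    have c: "limit_of (i f \<otimes>\<^bsub>G\<^esub> g \<otimes>\<^bsub>G\<^esub> inv\<^bsub>G\<^esub> i f)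
        (\<lambda>n. f \<otimes>\<^bsub>ThompsonF\<^esub> g\<^sub>n n \<otimes>\<^bsub>ThompsonF\<^esub> inv\<^bsub>ThompsonF\<^esub> f)"
      by (intro limits f)
    show "i f \<otimes>\<^bsub>G\<^esub> g \<otimes>\<^bsub>G\<^esub> inv\<^bsub>G\<^esub> i f \<otimes>\<^bsub>G\<^esub> g = g \<otimes>\<^bsub>G\<^esub> (i f \<otimes>\<^bsub>G\<^esub> g \<otimes>\<^bsub>G\<^esub> inv\<^bsub>G\<^esub> i f)"
      using comm limit_of_eq_iff[OF limit_of_mult[OF c lim_g] limit_of_mult[OF lim_g c]]
      by simp
  qed (use f in simp)

  \<comment> \<open>Eventual triviality near the endpoints\<close>
  have avoid: "\<forall>\<^sub>F n in sequentially. supp (g\<^sub>n n) \<inter> V = {}"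
    if f: "f \<in> thompson_elements" "supp f \<noteq> {}" "supp f \<subseteq> V"
      and ev: "\<forall>\<^sub>F n in sequentially. supp (g\<^sub>n n) \<inter> V = {} \<or> g\<^sub>n n ` supp f \<inter> supp f = {}" for f V
  proof -
    \<comment> \<open>Under either alternative the conjugate of \<open>f\<close> by
      \<open>g\<^sub>n n\<close> commutes with \<open>f\<close>: it equals \<open>f\<close>, or it
      has disjoint support.\<close>
    have "f \<in> H"
    proof (rule in_H1[OF f(1) eventually_mono[OF ev]])
      fix n
      let ?c = "g\<^sub>n n \<otimes>\<^bsub>ThompsonF\<^esub> f \<otimes>\<^bsub>ThompsonF\<^esub> inv\<^bsub>ThompsonF\<^esub> g\<^sub>n n"
      assume "supp (g\<^sub>n n) \<inter> V = {} \<or> g\<^sub>n n ` supp f \<inter> supp f = {}"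
      then show "?c \<otimes>\<^bsub>ThompsonF\<^esub> f = f \<otimes>\<^bsub>ThompsonF\<^esub> ?c"
      proof
        assume "supp (g\<^sub>n n) \<inter> V = {}"
        then have "g\<^sub>n n \<otimes>\<^bsub>ThompsonF\<^esub> f = f \<otimes>\<^bsub>ThompsonF\<^esub> g\<^sub>n n"
          using f(3) by (intro thompson_disjoint_supp_commute g\<^sub>n f(1)) blast
        then have "?c = f"
          using f(1) g\<^sub>n[of n] F.m_assoc[of f "g\<^sub>n n" "inv\<^bsub>ThompsonF\<^esub> g\<^sub>n n"]
          by (simp add: ThompsonF_inv_closed)
        then show ?thesis by simp
      qed (rule thompson_conj_commute[OF f(1) g\<^sub>n f(1)])
    qed
    \<comment> \<open>Now \<open>g\<^sub>n n\<close> eventually commutes with \<open>f\<close> and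
      hence maps its nonempty support into itself, which rules out the second alternative.\<close>
    from H_commute[OF this] ev show ?thesis
    proof eventually_elim
      case (elim n)
      obtain t where t: "t \<in> supp f"
        using f(2) by blast
      have "g\<^sub>n n t \<in> supp f"
        using thompson_commute_supp[OF f(1) g\<^sub>n elim(1)[symmetric] t] .
      with t elim(2) show ?case by blast
    qed
  qed

  obtain h0 h1 where h: "h0 \<in> H" "0 \<in> closure (supp h0)" "h1 \<in> H" "1 \<in> closure (supp h1)"
    using h' by auto
  then have hF: "h0 \<in> thompson_elements" "h1 \<in> thompson_elements"
    using H_sub by auto
  obtain b0 where b0: "0 < b0" "\<And>g e. g \<in> thompson_elements \<Longrightarrow>
       g \<otimes>\<^bsub>ThompsonF\<^esub> h0 = h0 \<otimes>\<^bsub>ThompsonF\<^esub> g \<Longrightarrow> 0 < e \<Longrightarrow> e \<le> b0 \<Longrightarrow>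
       supp g \<inter> {0..e} = {} \<or> g ` {e / 2<..<e} \<inter> {e / 2<..<e} = {}"
    using thompson_centralizer_near_0[OF hF(1) h(2)] by metis
  obtain b1 where b1: "0 < b1" "\<And>g e. g \<in> thompson_elements \<Longrightarrow>
       g \<otimes>\<^bsub>ThompsonF\<^esub> h1 = h1 \<otimes>\<^bsub>ThompsonF\<^esub> g \<Longrightarrow> 0 < e \<Longrightarrow> e \<le> b1 \<Longrightarrow> e \<le> 1 \<Longrightarrow>
       supp g \<inter> {1 - e..1} = {} \<or> g ` {1 - e<..<1 - e / 2} \<inter> {1 - e<..<1 - e / 2} = {}"
    using thompson_centralizer_near_1[OF hF(2) h(4)] by metis
  \<comment> \<open>A power of \<open>1 / 2\<close> is taken so that \<open>e\<close> and
    \<open>e / 2\<close> are dyadic and the bumps below belong to the group. It is fixed before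
    \<open>n\<close>, as \<open>b0\<close> and \<open>b1\<close> depend only on \<open>h0\<close>
    and \<open>h1\<close>.\<close>
  obtain j where j: "(1 / 2) ^ j < min b0 (min b1 1)"
    using real_arch_pow_inv[of "min b0 (min b1 1)" "1 / 2"] b0(1) b1(1) by auto
  define e :: real where "e = (1 / 2) ^ j"
  have e: "0 < e" "e \<le> b0" "e \<le> b1" "e \<le> 1"
    using j by (auto simp: e_def)
  have "e = 2 powi (- int j) * 1"
    unfolding e_def by (simp only: power_int_minus power_int_of_nat power_one_over inverse_eq_divide)
  then have dyadic: "e \<in> dyadic_rationals"
    using dyadic_rationals_powi[of 1 "- int j"] by simp
  moreover have "e / 2 \<in> dyadic_rationals"
    using dyadic_rationals_powi[OF dyadic, of "-1"] by simp
  ultimately have dyadic: "e \<in> dyadic_rationals" "e / 2 \<in> dyadic_rationals"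
    by blast+

  have "\<forall>\<^sub>F n in sequentially. supp (g\<^sub>n n) \<inter> {0..e} = {}"
  proof (rule avoid)
    show "thompson_bump (e / 2) (e / 2) \<in> thompson_elements"
      using dyadic e by (intro thompson_bump_closed) auto
    have supp: "supp (thompson_bump (e / 2) (e / 2)) = {e / 2<..<e}"
      using e by (simp add: supp_thompson_bump)
    show "supp (thompson_bump (e / 2) (e / 2)) \<noteq> {}" "supp (thompson_bump (e / 2) (e / 2)) \<subseteq> {0..e}"
      using e unfolding supp by auto
    show "\<forall>\<^sub>F n in sequentially. supp (g\<^sub>n n) \<inter> {0..e} = {} \<or>
        g\<^sub>n n ` supp (thompson_bump (e / 2) (e / 2)) \<inter> supp (thompson_bump (e / 2) (e / 2)) = {}"
      using H_commute[OF h(1)] unfolding supp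
      by (rule eventually_mono) (rule b0(2)[OF g\<^sub>n _ e(1,2)])
  qed
  moreover have "\<forall>\<^sub>F n in sequentially. supp (g\<^sub>n n) \<inter> {1 - e..1} = {}"
  proof (rule avoid)
    show "thompson_bump (1 - e) (e / 2) \<in> thompson_elements"
      using dyadic e by (intro thompson_bump_closed dyadic_rationals_diff) auto
    have supp: "supp (thompson_bump (1 - e) (e / 2)) = {1 - e<..<1 - e / 2}"
      using e by (simp add: supp_thompson_bump)
    show "supp (thompson_bump (1 - e) (e / 2)) \<noteq> {}" "supp (thompson_bump (1 - e) (e / 2)) \<subseteq> {1 - e..1}"
      using e unfolding supp by auto
    show "\<forall>\<^sub>F n in sequentially. supp (g\<^sub>n n) \<inter> {1 - e..1} = {} \<or>
        g\<^sub>n n ` supp (thompson_bump (1 - e) (e / 2)) \<inter> supp (thompson_bump (1 - e) (e / 2)) = {}"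
      using H_commute[OF h(3)] unfolding supp
      by (rule eventually_mono) (rule b1(2)[OF g\<^sub>n _ e(1,3,4)])
  qed
  ultimately have inner: "\<forall>\<^sub>F n in sequentially. supp (g\<^sub>n n) \<subseteq> {e..1 - e}"
  proof eventually_elim
    case (elim n)
    show ?case
    proof
      fix t
      assume "t \<in> supp (g\<^sub>n n)"
      moreover from this have "t \<notin> {0..e}" "t \<notin> {1 - e..1}" "t \<in> {0..1}"
        using elim by (auto simp: supp_def)
      ultimately show "t \<in> {e..1 - e}"
        by auto
    qed
  qed

  \<comment> \<open>Displacing the remaining support\<close>
  obtain f where f: "f \<in> thompson_elements" "f ` {e..1 - e} \<inter> {e..1 - e} = {}"
    using thompson_displace e(1) by blast
  \<comment> \<open>A single \<open>f\<close> works for almost all \<open>n\<close>, because the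
    supports all lie in the same interval. The conjugate of \<open>g\<^sub>n n\<close> by
    \<open>f\<close> then has support disjoint from that of \<open>g\<^sub>n n\<close>.\<close>
  have "f \<in> H"
    using inner by (intro in_H2[OF f(1)], elim eventually_mono)
      (rule thompson_conj_commute[OF g\<^sub>n f(1) g\<^sub>n], use f(2) in blast)
  from H_commute[OF this] inner have "\<forall>\<^sub>F n in sequentially. g\<^sub>n n = \<one>\<^bsub>ThompsonF\<^esub>"
  proof eventually_elim
    case (elim n)
    \<comment> \<open>Commuting with \<open>g\<^sub>n n\<close>, the element \<open>f\<close> maps
      this support into itself, but it also moves the surrounding interval off itself.\<close>
    have "supp (g\<^sub>n n) = {}"
      using thompson_commute_supp[OF g\<^sub>n f(1) elim(1)] elim(2) f(2) by blast
    then show ?case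
      using thompson_supp_empty[OF g\<^sub>n] by blast
  qed
  then have "g = \<one>\<^bsub>G\<^esub>"
    by (simp add: limit_of_eq_one_iff[OF lim_g])
  with is_HNN_extension_stable_ne_one[OF group_ThompsonF group_G H hnn] show False
    by simp
qed

end
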